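(* Let $K$ be a closed polyhedral cone in a finite dimensional real normed space $X$. If $\mathcal{A}$ is a bounded, equicontinuous family of order-preserving, homogeneous maps $f: K \to K$, then $$r(\mathcal{A}) = \hat{r}(\mathcal{A}),$$ that is, the generalized spectral radius and the joint spectral radius of $\mathcal{A}$ are equal.
   Context: A wedge in a real normed space is a convex set $W$ with $\lambda W \subseteq W$ for all real $\lambda>0$; a cone is a wedge $K$ with $K \cap (-K) = \{0\}$. A cone is polyhedral if it has a finite number of extreme rays. A closed cone $K$ defines the partial order $x \ge y \iff x-y \in K$. A map $f$ is order-preserving if $f(x)\ge f(y)$ whenever $x \ge y$, and homogeneous if $f(cx)=cf(x)$ for all $c>0$ and all $x$ in its domain. For a homogeneous map $f$ on a non-zero wedge $W$, $\|f\| := \sup\{\|f(x)\| : x \in W, \|x\|=1\}$, and $f$ is bounded if $\|f\|<\infty$. For bounded homogeneous $f:W\to W$, the (Bonsall) cone spectral radius is $r(f) := \lim_{n\to\infty}\|f^n\|^{1/n} = \inf_{n>0}\|f^n\|^{1/n}$. A family $\mathcal{A}$ of homogeneous maps is bounded if $\{\|f\| : f\in\mathcal{A}\}$ is bounded, and equicontinuous if it is pointwise equicontinuous (equicontinuous at every point of the domain). For $m\ge 1$, $\mathcal{A}^m := \{f_m\circ\cdots\circ f_1 : f_i\in\mathcal{A}\}$. The joint spectral radius is $$\hat r(\mathcal{A}) := \inf_{m>0}\sup_{f\in\mathcal{A}^m}\|f\|^{1/m} = \lim_{m\to\infty}\sup_{f\in\mathcal{A}^m}\|f\|^{1/m},$$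 and the generalized spectral radius is $$r(\mathcal{A}) := \limsup_{m\to\infty}\sup_{f\in\mathcal{A}^m} r(f)^{1/m} = \sup_{m>0}\sup_{f\in\mathcal{A}^m} r(f)^{1/m}.$$ *)

theory Defs
  imports "HOL-Analysis.Analysis"
begin

definition wedge :: "'a::real_vector set \<Rightarrow> bool" where
  "wedge W \<longleftrightarrow> convex W \<and> (\<forall>c>0. (*\<^sub>R) c ` W \<subseteq> W)"

text \<open>
  This differs from the library constant \<open>cone\<close>, which requires neither convexity nor pointedness.
\<close>
definition pointed_cone :: "'a::real_vector set \<Rightarrow> bool" where
  "pointed_cone K \<longleftrightarrow> wedge K \<and> K \<inter> uminus ` K = {0}"

definition extreme_ray_of :: "'a::real_vector set \<Rightarrow> 'a set \<Rightarrow> bool" (infixr \<open>(extreme'_ray'_of)\<close> 50) where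
  "R extreme_ray_of K \<longleftrightarrow> R face_of K \<and> (\<exists>x. x \<noteq> 0 \<and> R = {c *\<^sub>R x | c. c \<ge> 0})"

definition polyhedral_cone :: "'a::real_vector set \<Rightarrow> bool" where
  "polyhedral_cone K \<longleftrightarrow> pointed_cone K \<and> finite {R. R extreme_ray_of K}"

text \<open>
  Maps \<open>K \<rightarrow> K\<close> are represented by total functions; every notion below depends only on their
  values on \<open>K\<close>.
\<close>

definition cone_ge :: "'a::real_vector set \<Rightarrow> 'a \<Rightarrow> 'a \<Rightarrow> bool" where
  "cone_ge K x y \<longleftrightarrow> x - y \<in> K"

definition order_preserving_on :: "'a::real_vector set \<Rightarrow> ('a \<Rightarrow> 'a) \<Rightarrow> bool" where
  "order_preserving_on K f \<longleftrightarrow> (\<forall>x\<in>K. \<forall>y\<in>K. cone_ge K x y \<longrightarrow> cone_ge K (f x) (f y))"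

definition homogeneous_on :: "'a::real_vector set \<Rightarrow> ('a \<Rightarrow> 'a) \<Rightarrow> bool" where
  "homogeneous_on K f \<longleftrightarrow> (\<forall>c>0. \<forall>x\<in>K. f (c *\<^sub>R x) = c *\<^sub>R f x)"

definition equicontinuous_on :: "'a::metric_space set \<Rightarrow> ('a \<Rightarrow> 'a) set \<Rightarrow> bool" where
  "equicontinuous_on K A \<longleftrightarrow>
     (\<forall>x\<in>K. \<forall>e>0. \<exists>d>0. \<forall>f\<in>A. \<forall>y\<in>K. dist y x < d \<longrightarrow> dist (f y) (f x) < e)"

text \<open>
  Norms and spectral radii take values in \<open>[0, \<infinity>]\<close>, so that all suprema exist. A supremum over
  the empty set is \<open>0\<close>; in particular every map on the zero cone has norm \<open>0\<close>.
\<close>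
definition cone_norm :: "'a::real_normed_vector set \<Rightarrow> ('a \<Rightarrow> 'a) \<Rightarrow> ennreal" where
  "cone_norm K f = (SUP x\<in>{x\<in>K. norm x = 1}. ennreal (norm (f x)))"

definition bounded_family_on :: "'a::real_normed_vector set \<Rightarrow> ('a \<Rightarrow> 'a) set \<Rightarrow> bool" where
  "bounded_family_on K A \<longleftrightarrow> (SUP f\<in>A. cone_norm K f) < \<infinity>"

text \<open>The power \<open>x\<^sup>1\<^sup>/\<^sup>n\<close> for \<open>n > 0\<close>.\<close>
definition ennroot :: "nat \<Rightarrow> ennreal \<Rightarrow> ennreal" where
  "ennroot n x = (if x = \<infinity> then \<infinity> else ennreal (root n (enn2real x)))"

definition cone_spectral_radius :: "'a::real_normed_vector set \<Rightarrow> ('a \<Rightarrow> 'a) \<Rightarrow> ennreal" where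
  "cone_spectral_radius K f = lim (\<lambda>n. ennroot n (cone_norm K (f ^^ n)))"

text \<open>
  For \<open>fs = [f\<^sub>1, \<dots>, f\<^sub>m]\<close> the function \<open>fold (\<circ>) fs id\<close> is \<open>f\<^sub>m \<circ> \<dots> \<circ> f\<^sub>1\<close>.
\<close>
definition family_power :: "('a \<Rightarrow> 'a) set \<Rightarrow> nat \<Rightarrow> ('a \<Rightarrow> 'a) set" where
  "family_power A m = {fold (\<circ>) fs id | fs. length fs = m \<and> set fs \<subseteq> A}"

definition joint_spectral_radius ::
  "'a::real_normed_vector set \<Rightarrow> ('a \<Rightarrow> 'a) set \<Rightarrow> ennreal" where
  "joint_spectral_radius K A =
     (INF m\<in>{0<..}. SUP f\<in>family_power A m. ennroot m (cone_norm K f))"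

definition generalized_spectral_radius ::
  "'a::real_normed_vector set \<Rightarrow> ('a \<Rightarrow> 'a) set \<Rightarrow> ennreal" where
  "generalized_spectral_radius K A =
     limsup (\<lambda>m. SUP f\<in>family_power A m. ennroot m (cone_spectral_radius K f))"

end

theory Submission
  imports Defs
begin

text \<open>
  That the generalized spectral radius is at most the joint one is formal. If all products of \<open>p\<close>
  maps have norm at most \<open>s\<^sup>p\<close>, then submultiplicativity gives a constant \<open>C\<close> such that products of
  \<open>n\<close> maps have norm at most \<open>C s\<^sup>n\<close>; applied to the powers of one product \<open>g\<close> of length \<open>m\<close>, this
  bounds the spectral radius of \<open>g\<close> by \<open>s\<^sup>m\<close>.

  For the converse, a lower bound on a spectral radius comes from an inequality \<open>g w \<ge> d w\<close> in the
  cone order: the iterates then satisfy \<open>g\<^sup>n w \<ge> d\<^sup>n w\<close>, and this keeps the spectral radius of \<open>g\<close>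
  at least \<open>d\<close> (\<open>cone_spectral_radius_ge_of_expansion\<close>). So if \<open>s\<close> is below the joint spectral
  radius, a point \<open>w\<close> and arbitrarily long products \<open>g\<close> of length \<open>j\<close> with \<open>g w \<ge> s\<^sup>j w\<close> are needed.
  A constant factor in this inequality is harmless, because \<open>s\<close> can be lowered slightly and \<open>j\<close> is large.

  Products of large norm produce, by passing to limits of finite trajectories, an infinite orbit
  \<open>x\<^sub>0, x\<^sub>1, \<dots>\<close> with \<open>\<parallel>x\<^sub>0\<parallel> = 1\<close> and \<open>\<parallel>x\<^sub>n\<parallel> \<ge> t\<^sup>n\<close>, where \<open>t > s\<close>. It consists of limits of values of the maps
  rather than of values, but equicontinuity makes every \<open>x\<^sub>n\<close> a limit of points \<open>g x\<^sub>0\<close> with \<open>g\<close> a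
  product of length \<open>n\<close>. It remains to make the orbit return, in direction and up to a constant
  factor in the cone order, to its starting point. Two properties of a polyhedral cone are used:

  \<^item> a point close to \<open>u\<close> dominates \<open>u / 2\<close>, even when \<open>u\<close> lies on the boundary
    (\<open>half_below_nearby\<close>);
  \<^item> up to mutual domination by positive multiples there are only finitely many points
    (\<open>support_exists\<close>, \<open>equal_support_comparable\<close>); the classes are the relative interiors of the faces.

  To an orbit \<open>x\<close> of growth \<open>t\<close> attach the set of its omega-limits, that is, limits of the
  renormalized tails of \<open>x\<close>. Some omega-limit again has growth \<open>t\<close>, and an omega-limit of an
  omega-limit of \<open>x\<close> is an omega-limit of \<open>x\<close>. Hence the finite set of faces in which the omega-limits
  of growth \<open>t\<close> start can only shrink when \<open>x\<close> is replaced by one of them. If \<open>x\<close> makes this set as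
  small as possible, it does not shrink at all, and so an omega-limit \<open>y\<close> of growth \<open>t\<close> has itself an
  omega-limit starting in the face of \<open>y\<^sub>0\<close> (\<open>recurrent_support\<close>). This is the required return: the
  orbit \<open>y\<close> comes infinitely often near a direction \<open>u\<close> comparable with \<open>y\<^sub>0\<close>, so that
  \<open>y\<^sub>j \<ge> \<delta> t\<^sup>j y\<^sub>0\<close> for infinitely many \<open>j\<close> with \<open>\<delta> > 0\<close> fixed.

  The two properties of the cone are derived from a finite set of generators. A closed pointed cone in
  finite dimension is generated by its extreme rays; the argument is an induction on the dimension
  of the face of a point (\<open>mem_of_extreme_rays\<close>). Coefficients with respect to the generators are
  bounded by the norm, which also gives compactness of bounded parts of the cone.
\<close>

section \<open>Sequential compactness of countable products\<close>

lemma pointwise_convergent_subsequence: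
  fixes f :: "nat \<Rightarrow> nat \<Rightarrow> 'b::metric_space"
  assumes "\<And>i. compact (S i)" and "\<And>n i. f n i \<in> S i"
  obtains r l where "strict_mono r" "\<And>i. l i \<in> S i" "\<And>i. (\<lambda>n. f (r n) i) \<longlonglongrightarrow> l i"
proof -
  have "compactin (product_topology (\<lambda>i. euclidean) UNIV) (PiE UNIV S)"
    using assms(1) by (simp add: compactin_PiE)
  then have "compact (PiE UNIV S)"
    by (simp add: euclidean_product_topology)
  then have "seq_compact (PiE UNIV S)"
    by (rule compact_imp_seq_compact)
  then obtain l r where l: "l \<in> PiE UNIV S" and r: "strict_mono r" and lim: "(f \<circ> r) \<longlonglongrightarrow> l"
    using assms(2) unfolding seq_compact_def by (metis PiE_UNIV_domain Pi_I)
  have "(\<lambda>n. f (r n) i) \<longlonglongrightarrow> l i" for i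
  proof -
    have "isCont (\<lambda>x::nat \<Rightarrow> 'b. x i) l"
      by (rule continuous_on_eq_continuous_at[THEN iffD1, rule_format, OF open_UNIV])
        (auto intro: continuous_on_product_coordinates)
    from isCont_tendsto_compose[OF this lim] show ?thesis by (simp add: o_def)
  qed
  with l r show thesis by (intro that[of r l]) auto
qed

lemma pointwise_convergent_subsequence_finite:
  fixes f :: "nat \<Rightarrow> 'a \<Rightarrow> 'b::metric_space"
  assumes "finite I" "compact S" and "\<And>n i. i \<in> I \<Longrightarrow> f n i \<in> S"
  obtains r l where "strict_mono r" "\<And>i. i \<in> I \<Longrightarrow> l i \<in> S"
    "\<And>i. i \<in> I \<Longrightarrow> (\<lambda>n. f (r n) i) \<longlonglongrightarrow> l i"
proof (cases "I = {}")
  case True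
  then show thesis using that[of id] by (auto simp: strict_mono_def)
next
  case False
  \<comment> \<open>The index set is enumerated by all natural numbers, with repetitions.\<close>
  have "f n (from_nat_into I k) \<in> S" for n k
    using assms(3) from_nat_into[OF False] by blast
  from pointwise_convergent_subsequence[of "\<lambda>_. S" "\<lambda>n k. f n (from_nat_into I k)", OF assms(2) this]
  obtain r l where rl: "strict_mono r" "\<And>k. l k \<in> S"
      "\<And>k. (\<lambda>n. f (r n) (from_nat_into I k)) \<longlonglongrightarrow> l k"
    by blast
  have *: "from_nat_into I (to_nat_on I i) = i" if "i \<in> I" for i
    using that assms(1) by (simp add: countable_finite)
  have "(\<lambda>n. f (r n) i) \<longlonglongrightarrow> l (to_nat_on I i)" if "i \<in> I" for i
    using rl(3)[of "to_nat_on I i"] *[OF that] by simp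
  with rl(1,2) show thesis by (rule that)
qed

section \<open>Submultiplicative sequences\<close>

text \<open>
  Writing \<open>n = p q + r\<close> with \<open>r < p\<close>, the bound at \<open>p\<close> is used \<open>q\<close> times and \<open>C\<close> absorbs the finitely
  many remainders.
\<close>
lemma submultiplicative_exponential_bound:
  fixes a :: "nat \<Rightarrow> real"
  assumes nonneg: "\<And>n. 0 \<le> a n" and submult: "\<And>m n. a (m + n) \<le> a m * a n"
    and "p > 0" "s > 0" "a p \<le> s ^ p"
  obtains C where "C > 0" "\<And>n. a n \<le> C * s ^ n"
proof -
  define C where "C = 1 + (\<Sum>r<p. a r / s ^ r)"
  have "C > 0"
    unfolding C_def using nonneg \<open>s > 0\<close> by (intro add_pos_nonneg sum_nonneg) auto
  have rem: "a r \<le> C * s ^ r" if "r < p" for r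
  proof -
    have "a r / s ^ r \<le> (\<Sum>r<p. a r / s ^ r)"
      using that nonneg \<open>s > 0\<close> by (intro member_le_sum) auto
    then have "a r / s ^ r \<le> C" by (simp add: C_def)
    with \<open>s > 0\<close> show ?thesis by (simp add: divide_le_eq)
  qed
  have "a (p * q + r) \<le> C * s ^ (p * q + r)" if "r < p" for q r
  proof (induction q)
    case 0
    then show ?case using rem[OF that] by simp
  next
    case (Suc q)
    have "a (p * Suc q + r) \<le> a p * a (p * q + r)"
      using submult[of p "p * q + r"] by (simp add: algebra_simps)
    also have "\<dots> \<le> s ^ p * (C * s ^ (p * q + r))"
      using Suc assms(5) nonneg \<open>s > 0\<close> by (intro mult_mono) auto
    also have "\<dots> = C * s ^ (p * Suc q + r)"
      by (simp add: power_add)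
    finally show ?case .
  qed
  from this[of "n mod p" "n div p" for n] have "a n \<le> C * s ^ n" for n
    using \<open>p > 0\<close> by simp
  with \<open>C > 0\<close> show thesis by (rule that)
qed

lemma root_power_bound:
  assumes "0 \<le> C" "0 \<le> s" "0 \<le> x" "x \<le> C * s ^ n" "n > 0"
  shows "root n x \<le> root n C * s"
proof -
  have "root n x \<le> root n (C * s ^ n)"
    using assms by simp
  also have "\<dots> = root n C * s"
    using assms by (simp add: real_root_mult real_root_power_cancel)
  finally show ?thesis .
qed

lemma tendsto_root_const_mult:
  assumes "0 < C"
  shows "(\<lambda>n. root n C * s) \<longlonglongrightarrow> s"
  using tendsto_mult[OF LIMSEQ_root_const[OF assms] tendsto_const[of s]] by simp

text \<open>
  Fekete's lemma: the limit is the infimum over positive exponents. The radius in question is defined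
  through \<^const>\<open>lim\<close>, which says something only once convergence is known.
\<close>
lemma submultiplicative_root_convergent:
  fixes a :: "nat \<Rightarrow> real"
  assumes nonneg: "\<And>n. 0 \<le> a n" and submult: "\<And>m n. a (m + n) \<le> a m * a n"
  shows "convergent (\<lambda>n. root n (a n))"
proof -
  define L where "L = (INF n\<in>{0<..}. root n (a n))"
  have bdd: "bdd_below ((\<lambda>n. root n (a n)) ` {0<..})"
    by (rule bdd_belowI[of _ 0]) (use nonneg in auto)
  have lower: "L \<le> root n (a n)" if "n > 0" for n
    unfolding L_def using bdd that by (intro cINF_lower) auto
  have "0 \<le> L"
    unfolding L_def by (rule cINF_greatest) (use nonneg in auto)
  have "(\<lambda>n. root n (a n)) \<longlonglongrightarrow> L"
  proof (rule order_tendstoI)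
    fix y assume "y < L"
    show "\<forall>\<^sub>F n in sequentially. y < root n (a n)"
      by (rule eventually_mono[OF eventually_gt_at_top[of 0]]) (rule less_le_trans[OF \<open>y < L\<close> lower])
  next
    fix y assume "L < y"
    then obtain p where p: "p > 0" "root p (a p) < y"
      unfolding L_def using bdd by (subst (asm) cINF_less_iff) auto
    define s where "s = (max L (root p (a p)) + y) / 2"
    have s: "root p (a p) < s" "s < y" "0 < s"
      using p \<open>L < y\<close> \<open>0 \<le> L\<close> by (auto simp: s_def)
    have "a p = root p (a p) ^ p"
      using p nonneg by simp
    also have "\<dots> \<le> s ^ p"
      using s p nonneg by (intro power_mono) auto
    finally obtain C where C: "C > 0" "\<And>n. a n \<le> C * s ^ n"
      using submultiplicative_exponential_bound[OF nonneg submult \<open>p > 0\<close> \<open>0 < s\<close>] by blast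
    have "\<forall>\<^sub>F n in sequentially. root n C * s < y"
      using tendsto_root_const_mult[OF C(1)] s(2) by (rule order_tendstoD(2))
    then show "\<forall>\<^sub>F n in sequentially. root n (a n) < y"
      using eventually_gt_at_top[of 0]
    proof eventually_elim
      case (elim n)
      have "root n (a n) \<le> root n C * s"
        using C s(3) nonneg elim(2) by (intro root_power_bound) (auto intro: less_imp_le)
      with elim show ?case by simp
    qed
  qed
  then show ?thesis by (rule convergentI)
qed

section \<open>Norms of homogeneous maps on a wedge\<close>

lemma wedge_scaleR: "wedge W \<Longrightarrow> x \<in> W \<Longrightarrow> c > 0 \<Longrightarrow> c *\<^sub>R x \<in> W"
  unfolding wedge_def by blast

lemma wedge_add:
  assumes "wedge W" "x \<in> W" "y \<in> W"
  shows "x + y \<in> W"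
proof -
  have "(1/2) *\<^sub>R x + (1/2) *\<^sub>R y \<in> W"
    using assms unfolding wedge_def by (intro convexD) auto
  from wedge_scaleR[OF assms(1) this, of 2] show ?thesis
    by (simp add: scaleR_right_distrib)
qed

lemma homogeneous_zero:
  assumes "homogeneous_on K f" "0 \<in> K"
  shows "f 0 = 0"
proof -
  have "f (2 *\<^sub>R 0) = 2 *\<^sub>R f 0"
    using assms unfolding homogeneous_on_def by (metis zero_less_numeral)
  then show ?thesis by (simp add: scaleR_2)
qed

lemma cone_norm_le_iff:
  assumes W: "wedge K" and hom: "homogeneous_on K f" and "0 \<le> c"
  shows "cone_norm K f \<le> ennreal c \<longleftrightarrow> (\<forall>x\<in>K. norm (f x) \<le> c * norm x)"
proof
  assume "\<forall>x\<in>K. norm (f x) \<le> c * norm x"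
  then show "cone_norm K f \<le> ennreal c"
    unfolding cone_norm_def by (intro SUP_least ennreal_leI) auto
next
  assume le: "cone_norm K f \<le> ennreal c"
  show "\<forall>x\<in>K. norm (f x) \<le> c * norm x"
  proof
    fix x assume "x \<in> K"
    show "norm (f x) \<le> c * norm x"
    proof (cases "x = 0")
      case True
      with \<open>x \<in> K\<close> homogeneous_zero[OF hom] show ?thesis by simp
    next
      case False
      define u where "u = (1 / norm x) *\<^sub>R x"
      have u: "u \<in> K" "norm u = 1"
        using False \<open>x \<in> K\<close> wedge_scaleR[OF W] by (auto simp: u_def)
      have "ennreal (norm (f u)) \<le> cone_norm K f"
        unfolding cone_norm_def using u by (intro SUP_upper) auto
      with le have "ennreal (norm (f u)) \<le> ennreal c" by simp
      then have "norm (f u) \<le> c" using \<open>0 \<le> c\<close> by simp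
      moreover have "f u = (1 / norm x) *\<^sub>R f x"
        using False \<open>x \<in> K\<close> hom unfolding u_def homogeneous_on_def by (meson zero_less_divide_1_iff zero_less_norm_iff)
      ultimately show ?thesis using False by (simp add: field_simps)
    qed
  qed
qed

lemma ennroot_ennreal: "0 \<le> x \<Longrightarrow> ennroot n (ennreal x) = ennreal (root n x)"
  by (simp add: ennroot_def)

lemma ennroot_mono:
  assumes "n > 0" "x \<le> y"
  shows "ennroot n x \<le> ennroot n y"
proof (cases y)
  case (real b)
  then obtain a where "x = ennreal a" "0 \<le> a"
    using assms by (cases x) (auto simp: top_unique)
  with real assms show ?thesis
    by (simp add: ennroot_ennreal ennreal_leI)
qed (simp add: ennroot_def)

lemma ennroot_le_iff:
  assumes "n > 0" "0 \<le> s"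
  shows "ennroot n x \<le> ennreal s \<longleftrightarrow> x \<le> ennreal (s ^ n)"
proof (cases x)
  case (real r)
  have "root n r \<le> s \<longleftrightarrow> root n r \<le> root n (s ^ n)"
    using assms by (simp add: real_root_power_cancel)
  also have "\<dots> \<longleftrightarrow> r \<le> s ^ n"
    using assms by (simp del: real_root_power_cancel)
  finally show ?thesis using real assms by (simp add: ennroot_ennreal)
qed (simp add: ennroot_def top_unique)

section \<open>Products of a family\<close>

lemma fold_comp_id:
  fixes h :: "'a \<Rightarrow> 'a"
  shows "fold (\<circ>) fs h = fold (\<circ>) fs id \<circ> h"
proof (induction fs arbitrary: h)
  case (Cons f fs)
  show ?case using Cons[of "f \<circ> h"] Cons[of f] by (simp add: o_assoc)
qed simp

lemma family_power_0: "family_power A 0 = {id}"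
  by (auto simp: family_power_def)

lemma family_power_Suc: "family_power A (Suc m) = {h \<circ> g | h g. h \<in> family_power A m \<and> g \<in> A}"
proof (intro set_eqI iffI)
  fix f assume "f \<in> family_power A (Suc m)"
  then obtain fs where fs: "f = fold (\<circ>) fs id" "length fs = Suc m" "set fs \<subseteq> A"
    by (auto simp: family_power_def)
  then obtain g hs where gs: "fs = g # hs" by (cases fs) auto
  have "f = fold (\<circ>) hs id \<circ> g"
    using fs gs by (simp add: fold_comp_id[of hs g])
  moreover have "fold (\<circ>) hs id \<in> family_power A m" "g \<in> A"
    using fs gs by (auto simp: family_power_def)
  ultimately show "f \<in> {h \<circ> g | h g. h \<in> family_power A m \<and> g \<in> A}"
    by blast
next
  fix f assume "f \<in> {h \<circ> g | h g. h \<in> family_power A m \<and> g \<in> A}"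
  then obtain g hs where "f = fold (\<circ>) hs id \<circ> g" "length hs = m" "set hs \<subseteq> A" "g \<in> A"
    by (auto simp: family_power_def)
  then have "f = fold (\<circ>) (g # hs) id" "length (g # hs) = Suc m" "set (g # hs) \<subseteq> A"
    by (simp_all add: fold_comp_id[of hs g])
  then show "f \<in> family_power A (Suc m)"
    unfolding family_power_def by blast
qed

lemma family_power_1: "family_power A (Suc 0) = A"
  by (auto simp: family_power_Suc family_power_0)

lemma family_power_add: "family_power A (m + n) = {h \<circ> g | h g. h \<in> family_power A n \<and> g \<in> family_power A m}"
proof (induction m)
  case (Suc m)
  have "family_power A (Suc m + n) =
      {h \<circ> g \<circ> f | h g f. h \<in> family_power A n \<and> g \<in> family_power A m \<and> f \<in> A}"
    unfolding add_Suc family_power_Suc Suc.IH by blast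
  also have "\<dots> = {h \<circ> g | h g. h \<in> family_power A n \<and> g \<in> family_power A (Suc m)}"
    unfolding family_power_Suc comp_assoc by blast
  finally show ?case .
qed (simp add: family_power_0)

lemma funpow_in_family_power: "f \<in> family_power A m \<Longrightarrow> f ^^ n \<in> family_power A (m * n)"
proof (induction n)
  case (Suc n)
  then have "f \<circ> f ^^ n \<in> family_power A (m * n + m)"
    by (subst family_power_add) auto
  then show ?case by (metis add.commute funpow.simps(2) mult_Suc_right)
qed (simp add: family_power_0)

lemma family_power_singleton: "family_power {f} n = {f ^^ n}"
proof (induction n)
  case (Suc n)
  then show ?case by (auto simp: family_power_Suc funpow_swap1 fun_eq_iff)
qed (simp add: family_power_0 id_def fun_eq_iff)

text \<open>
  Besides \<open>A\<close> itself, the intended instances are the one-element families \<open>{f}\<close> with \<open>f\<close> a product of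
  members of \<open>A\<close>: results on families then apply to the powers of a single map.
\<close>
locale bounded_homogeneous_family =
  fixes K :: "'a::real_normed_vector set" and A :: "('a \<Rightarrow> 'a) set"
  assumes wedge: "wedge K"
    and maps: "f \<in> A \<Longrightarrow> x \<in> K \<Longrightarrow> f x \<in> K"
    and homogeneous: "f \<in> A \<Longrightarrow> homogeneous_on K f"
    and bounded: "bounded_family_on K A"
begin

definition bound :: real where
  "bound = enn2real (SUP f\<in>A. cone_norm K f)"

lemma bound_nonneg: "0 \<le> bound"
  by (simp add: bound_def)

lemma norm_le_bound: "norm (f x) \<le> bound * norm x" if "f \<in> A" "x \<in> K"
proof -
  have "cone_norm K f \<le> (SUP f\<in>A. cone_norm K f)"
    using that by (intro SUP_upper)
  also have "\<dots> = ennreal bound"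
    using bounded by (simp add: bounded_family_on_def bound_def)
  finally show ?thesis
    using cone_norm_le_iff[OF wedge homogeneous[OF that(1)] bound_nonneg] that by blast
qed

lemma family_power_maps: "f \<in> family_power A m \<Longrightarrow> x \<in> K \<Longrightarrow> f x \<in> K"
  by (induction m arbitrary: f x) (auto simp: family_power_0 family_power_Suc maps)

lemma family_power_scaleR:
  "f \<in> family_power A m \<Longrightarrow> x \<in> K \<Longrightarrow> c > 0 \<Longrightarrow> f (c *\<^sub>R x) = c *\<^sub>R f x"
proof (induction m arbitrary: f x)
  case (Suc m)
  then obtain h g where hg: "f = h \<circ> g" "h \<in> family_power A m" "g \<in> A"
    by (auto simp: family_power_Suc)
  have "g (c *\<^sub>R x) = c *\<^sub>R g x"
    using homogeneous[OF hg(3)] Suc.prems by (simp add: homogeneous_on_def)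
  with hg Suc.IH[of h "g x"] Suc.prems maps show ?case by simp
qed (simp add: family_power_0)

lemma family_power_norm_le: "f \<in> family_power A m \<Longrightarrow> x \<in> K \<Longrightarrow> norm (f x) \<le> bound ^ m * norm x"
proof (induction m arbitrary: f x)
  case (Suc m)
  then obtain h g where hg: "f = h \<circ> g" "h \<in> family_power A m" "g \<in> A"
    by (auto simp: family_power_Suc)
  have "norm (f x) \<le> bound ^ m * norm (g x)"
    using hg Suc maps by simp
  also have "\<dots> \<le> bound ^ m * (bound * norm x)"
    using norm_le_bound hg Suc.prems bound_nonneg by (intro mult_left_mono) auto
  finally show ?case by (simp add: mult_ac)
qed (simp add: family_power_0)

lemma family_power_homogeneous: "f \<in> family_power A m \<Longrightarrow> homogeneous_on K f"
  using family_power_scaleR by (auto simp: homogeneous_on_def)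

lemma cone_norm_family_power_le: "f \<in> family_power A m \<Longrightarrow> cone_norm K f \<le> ennreal (bound ^ m)"
  using cone_norm_le_iff[OF wedge family_power_homogeneous] family_power_norm_le bound_nonneg by simp

lemma singleton_family:
  assumes "f \<in> family_power A m"
  shows "bounded_homogeneous_family K {f}"
proof
  have "cone_norm K f < \<infinity>"
    using cone_norm_family_power_le[OF assms] by (auto intro: le_less_trans)
  then show "bounded_family_on K {f}"
    by (simp add: bounded_family_on_def)
qed (use wedge family_power_maps[OF assms] family_power_homogeneous[OF assms] in auto)

definition power_norm :: "nat \<Rightarrow> real" where
  "power_norm m = enn2real (SUP f\<in>family_power A m. cone_norm K f)"

lemma power_norm_nonneg: "0 \<le> power_norm m"
  by (simp add: power_norm_def)

lemma ennreal_power_norm: "ennreal (power_norm m) = (SUP f\<in>family_power A m. cone_norm K f)"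
proof -
  have "(SUP f\<in>family_power A m. cone_norm K f) \<le> ennreal (bound ^ m)"
    by (intro SUP_least cone_norm_family_power_le)
  then have "(SUP f\<in>family_power A m. cone_norm K f) < \<infinity>"
    by (auto intro: le_less_trans)
  then show ?thesis by (simp add: power_norm_def)
qed

lemma norm_le_power_norm:
  assumes "f \<in> family_power A m" "x \<in> K"
  shows "norm (f x) \<le> power_norm m * norm x"
proof -
  have "cone_norm K f \<le> ennreal (power_norm m)"
    unfolding ennreal_power_norm using assms by (intro SUP_upper)
  then show ?thesis
    using cone_norm_le_iff[OF wedge family_power_homogeneous[OF assms(1)] power_norm_nonneg] assms(2) by blast
qed

lemma power_norm_least:
  assumes "0 \<le> c" "\<And>f x. f \<in> family_power A m \<Longrightarrow> x \<in> K \<Longrightarrow> norm (f x) \<le> c * norm x"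
  shows "power_norm m \<le> c"
proof -
  have "ennreal (power_norm m) \<le> ennreal c"
    unfolding ennreal_power_norm using assms
    by (intro SUP_least) (simp add: cone_norm_le_iff[OF wedge family_power_homogeneous])
  with assms(1) show ?thesis by simp
qed

lemma power_norm_submultiplicative: "power_norm (m + n) \<le> power_norm m * power_norm n"
proof (rule power_norm_least)
  fix f x assume "f \<in> family_power A (m + n)" "x \<in> K"
  then obtain h g where hg: "f = h \<circ> g" "h \<in> family_power A n" "g \<in> family_power A m"
    by (auto simp: family_power_add)
  have "norm (f x) \<le> power_norm n * norm (g x)"
    using hg norm_le_power_norm family_power_maps \<open>x \<in> K\<close> by simp
  also have "\<dots> \<le> power_norm n * (power_norm m * norm x)"
    using norm_le_power_norm[OF hg(3) \<open>x \<in> K\<close>] power_norm_nonneg by (intro mult_left_mono)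
  finally show "norm (f x) \<le> power_norm m * power_norm n * norm x" by (simp add: mult_ac)
qed (simp add: power_norm_nonneg)

end

section \<open>The cone spectral radius of a product\<close>

text \<open>
  The products of the family \<open>{f}\<close> are the powers of \<open>f\<close>, so its sequence of norms is submultiplicative.
\<close>
lemma cone_spectral_radius_limit:
  assumes "bounded_homogeneous_family K {f}"
  defines "a \<equiv> bounded_homogeneous_family.power_norm K {f}"
  obtains L where "(\<lambda>n. root n (a n)) \<longlonglongrightarrow> L" "cone_spectral_radius K f = ennreal L"
proof -
  interpret bounded_homogeneous_family K "{f}" by fact
  have a: "a = power_norm" by (simp add: a_def)
  have "convergent (\<lambda>n. root n (a n))"
    unfolding a by (intro submultiplicative_root_convergent power_norm_nonneg power_norm_submultiplicative)
  then obtain L where L: "(\<lambda>n. root n (a n)) \<longlonglongrightarrow> L" by (auto simp: convergent_def)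
  have "cone_norm K (f ^^ n) = ennreal (a n)" for n
    unfolding a ennreal_power_norm family_power_singleton by simp
  then have "ennroot n (cone_norm K (f ^^ n)) = ennreal (root n (a n))" for n
    by (simp add: ennroot_ennreal a power_norm_nonneg)
  then have "(\<lambda>n. ennroot n (cone_norm K (f ^^ n))) \<longlonglongrightarrow> ennreal L"
    using L by simp
  then have "cone_spectral_radius K f = ennreal L"
    unfolding cone_spectral_radius_def by (rule limI)
  with L show thesis by (rule that)
qed

lemma cone_spectral_radius_le:
  assumes "bounded_homogeneous_family K {f}" "0 < C" "0 \<le> c"
    and le: "\<And>n x. x \<in> K \<Longrightarrow> norm ((f ^^ n) x) \<le> C * c ^ n * norm x"
  shows "cone_spectral_radius K f \<le> ennreal c"
proof -
  interpret bounded_homogeneous_family K "{f}" by fact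
  obtain L where L: "(\<lambda>n. root n (power_norm n)) \<longlonglongrightarrow> L" "cone_spectral_radius K f = ennreal L"
    using cone_spectral_radius_limit[OF assms(1)] .
  have "power_norm n \<le> C * c ^ n" for n
    by (rule power_norm_least) (use assms in \<open>auto simp: family_power_singleton\<close>)
  then have "\<forall>n>0. root n (power_norm n) \<le> root n C * c"
    using assms power_norm_nonneg by (intro allI impI root_power_bound) auto
  then have "L \<le> c"
    by (intro LIMSEQ_le[OF L(1) tendsto_root_const_mult[OF \<open>0 < C\<close>]] exI[of _ 1]) auto
  with L show ?thesis by (simp add: ennreal_leI)
qed

lemma cone_spectral_radius_ge:
  assumes "bounded_homogeneous_family K {f}" "0 < C" "0 \<le> c" "w \<in> K" "norm w = 1"
    and ge: "\<And>n. C * c ^ n \<le> norm ((f ^^ n) w)"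
  shows "ennreal c \<le> cone_spectral_radius K f"
proof -
  interpret bounded_homogeneous_family K "{f}" by fact
  obtain L where L: "(\<lambda>n. root n (power_norm n)) \<longlonglongrightarrow> L" "cone_spectral_radius K f = ennreal L"
    using cone_spectral_radius_limit[OF assms(1)] .
  have "root n C * c \<le> root n (power_norm n)" if "n > 0" for n
  proof -
    have "C * c ^ n \<le> power_norm n"
      using norm_le_power_norm[of "f ^^ n" n w] assms(4,5)
      by (intro order_trans[OF ge]) (simp add: family_power_singleton)
    then have "root n (C * c ^ n) \<le> root n (power_norm n)" using that by simp
    then show ?thesis
      using that assms by (simp add: real_root_mult real_root_power_cancel)
  qed
  then have "c \<le> L"
    by (intro LIMSEQ_le[OF tendsto_root_const_mult[OF \<open>0 < C\<close>] L(1)] exI[of _ 1]) auto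
  with L show ?thesis by (simp add: ennreal_leI)
qed

section \<open>The generalized spectral radius is at most the joint spectral radius\<close>

lemma ennreal_le_by_upper_reals:
  fixes x y :: ennreal
  assumes "\<And>s. 0 < s \<Longrightarrow> y < ennreal s \<Longrightarrow> x \<le> ennreal s"
  shows "x \<le> y"
proof (rule ccontr)
  assume "\<not> x \<le> y"
  then obtain z where z: "y < z" "z < x" using dense[of y x] by (auto simp: not_le)
  then obtain s where "z = ennreal s" "0 \<le> s" by (cases z) auto
  with z assms[of s] show False by (cases "s = 0") auto
qed

context bounded_homogeneous_family
begin

lemma generalized_le_joint: "generalized_spectral_radius K A \<le> joint_spectral_radius K A"
proof (rule ennreal_le_by_upper_reals)
  fix s :: real assume "0 < s" "joint_spectral_radius K A < ennreal s"
  then obtain p where "p > 0" and p: "(SUP f\<in>family_power A p. ennroot p (cone_norm K f)) < ennreal s"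
    by (auto simp: joint_spectral_radius_def INF_less_iff)
  have "cone_norm K f \<le> ennreal (s ^ p)" if "f \<in> family_power A p" for f
  proof -
    have "ennroot p (cone_norm K f) \<le> ennreal s"
      by (rule less_imp_le[OF SUP_lessD[OF p that]])
    with \<open>p > 0\<close> \<open>0 < s\<close> show ?thesis by (simp add: ennroot_le_iff)
  qed
  then have "power_norm p \<le> s ^ p"
    using \<open>0 < s\<close> by (intro power_norm_least)
      (auto simp: cone_norm_le_iff[OF wedge family_power_homogeneous])
  then obtain C where C: "C > 0" "\<And>n. power_norm n \<le> C * s ^ n"
    using submultiplicative_exponential_bound[OF power_norm_nonneg power_norm_submultiplicative \<open>p > 0\<close> \<open>0 < s\<close>]
    by blast
  have "ennroot m (cone_spectral_radius K f) \<le> ennreal s" if "m > 0" "f \<in> family_power A m" for m f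
  proof -
    have "norm ((f ^^ n) x) \<le> C * (s ^ m) ^ n * norm x" if "x \<in> K" for n x
    proof -
      have "norm ((f ^^ n) x) \<le> power_norm (m * n) * norm x"
        using funpow_in_family_power \<open>f \<in> _\<close> that norm_le_power_norm by blast
      also have "\<dots> \<le> C * s ^ (m * n) * norm x"
        using C by (intro mult_right_mono) auto
      finally show ?thesis by (simp add: power_mult)
    qed
    then have "cone_spectral_radius K f \<le> ennreal (s ^ m)"
      using cone_spectral_radius_le[OF singleton_family[OF that(2)] C(1)] \<open>0 < s\<close> by simp
    with that \<open>0 < s\<close> show ?thesis by (simp add: ennroot_le_iff)
  qed
  then show "generalized_spectral_radius K A \<le> ennreal s"
    unfolding generalized_spectral_radius_def
    by (intro Limsup_bounded eventually_mono[OF eventually_gt_at_top[of 0]] SUP_least) auto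
qed

end

lemma generalized_spectral_radius_ge:
  assumes "0 \<le> s" and ex: "\<And>n. \<exists>j\<ge>n. \<exists>g\<in>family_power A j. ennreal (s ^ j) \<le> cone_spectral_radius K g"
  shows "ennreal s \<le> generalized_spectral_radius K A"
  unfolding generalized_spectral_radius_def limsup_INF_SUP
proof (rule INF_greatest)
  fix n :: nat
  obtain j g where j: "j \<ge> Suc n" "g \<in> family_power A j" "ennreal (s ^ j) \<le> cone_spectral_radius K g"
    using ex by blast
  have "ennreal s = ennroot j (ennreal (s ^ j))"
    using j(1) \<open>0 \<le> s\<close> by (simp add: ennroot_ennreal real_root_power_cancel)
  also have "\<dots> \<le> ennroot j (cone_spectral_radius K g)"
    using j by (intro ennroot_mono) auto
  also have "\<dots> \<le> (SUP f\<in>family_power A j. ennroot j (cone_spectral_radius K f))"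
    using j(2) by (rule SUP_upper)
  also have "\<dots> \<le> (SUP m\<in>{n..}. SUP f\<in>family_power A m. ennroot m (cone_spectral_radius K f))"
    using j(1) by (intro SUP_upper) auto
  finally show "ennreal s \<le> (SUP m\<in>{n..}. SUP f\<in>family_power A m. ennroot m (cone_spectral_radius K f))" .
qed

section \<open>Closed pointed cones\<close>

lemma closed_separation:
  fixes x :: "'a::metric_space"
  assumes "closed S" "x \<notin> S"
  obtains e where "e > 0" "\<And>y. y \<in> S \<Longrightarrow> e \<le> dist y x"
proof -
  have "open (- S)" "x \<in> - S" using assms by auto
  then obtain e where "e > 0" "\<And>y. dist y x < e \<Longrightarrow> y \<in> - S"
    unfolding open_dist by blast
  then show thesis by (intro that[of e]) (auto simp: not_less[symmetric])
qed

locale closed_cone =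
  fixes K :: "'a::real_normed_vector set"
  assumes closed: "closed K" and pointed: "pointed_cone K"
begin

lemma is_wedge: "wedge K"
  using pointed by (simp add: pointed_cone_def)

lemma zero_mem: "0 \<in> K"
  using pointed by (auto simp: pointed_cone_def)

lemma add_mem: "x \<in> K \<Longrightarrow> y \<in> K \<Longrightarrow> x + y \<in> K"
  using wedge_add[OF is_wedge] .

lemma scaleR_mem: "x \<in> K \<Longrightarrow> 0 \<le> c \<Longrightarrow> c *\<^sub>R x \<in> K"
  using wedge_scaleR[OF is_wedge] zero_mem by (cases "c = 0") auto

lemma sum_mem: "(\<And>i. i \<in> I \<Longrightarrow> f i \<in> K) \<Longrightarrow> sum f I \<in> K"
  by (induction I rule: infinite_finite_induct) (auto simp: zero_mem add_mem)

lemma antisym: "x \<in> K \<Longrightarrow> - x \<in> K \<Longrightarrow> x = 0"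
  using pointed by (force simp: pointed_cone_def)

lemma minus_scaleR_mono:
  assumes "x - c *\<^sub>R y \<in> K" "d \<le> c" "y \<in> K"
  shows "x - d *\<^sub>R y \<in> K"
proof -
  have "(x - c *\<^sub>R y) + (c - d) *\<^sub>R y \<in> K"
    using assms by (intro add_mem scaleR_mem) auto
  then show ?thesis by (simp add: algebra_simps)
qed

lemma minus_scaleR_trans:
  assumes "x - c *\<^sub>R y \<in> K" "y - d *\<^sub>R z \<in> K" "0 \<le> c"
  shows "x - (c * d) *\<^sub>R z \<in> K"
proof -
  have "(x - c *\<^sub>R y) + c *\<^sub>R (y - d *\<^sub>R z) \<in> K"
    using assms by (intro add_mem scaleR_mem) auto
  then show ?thesis by (simp add: algebra_simps)
qed

text \<open>
  The multiples of \<open>y\<close> below \<open>x\<close> are bounded because \<open>(x - t y) / t\<close> tends to \<open>- y\<close>, which lies outside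
  the closed set \<open>K\<close>.
\<close>
lemma largest_multiple_below:
  assumes "x \<in> K" "y \<in> K" "y \<noteq> 0"
  obtains t where "0 \<le> t" "x - t *\<^sub>R y \<in> K" "\<And>s. x - s *\<^sub>R y \<in> K \<Longrightarrow> s \<le> t"
proof -
  have "- y \<notin> K" using antisym assms by blast
  then obtain e where e: "e > 0" "\<And>z. z \<in> K \<Longrightarrow> e \<le> dist z (- y)"
    using closed_separation[OF closed] by blast
  define T where "T = (\<lambda>t. x - t *\<^sub>R y) -` K"
  have bound: "t \<le> norm x / e" if "t \<in> T" for t
  proof (cases "t > 0")
    case True
    have "(1 / t) *\<^sub>R (x - t *\<^sub>R y) \<in> K"
      using that True by (intro scaleR_mem) (auto simp: T_def)
    then have "e \<le> norm ((1 / t) *\<^sub>R x)"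
      using e(2)[of "(1 / t) *\<^sub>R (x - t *\<^sub>R y)"] True by (simp add: dist_norm algebra_simps)
    with True e(1) show ?thesis by (simp add: field_simps)
  next
    case False
    then have "t \<le> 0" by simp
    also have "0 \<le> norm x / e" using e by simp
    finally show ?thesis .
  qed
  have "closed T"
    unfolding T_def by (rule closed_vimage[OF closed]) (intro continuous_intros)
  moreover have "0 \<in> T" using assms by (simp add: T_def)
  moreover have bdd: "bdd_above T" using bound by (rule bdd_aboveI)
  ultimately have "Sup T \<in> T" by (intro closed_contains_Sup) auto
  with \<open>0 \<in> T\<close> bdd show thesis
    by (intro that[of "Sup T"]) (auto simp: T_def intro: cSup_upper)
qed

text \<open>
  For \<open>x \<in> K\<close> this is the smallest face of \<open>K\<close> containing \<open>x\<close>.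
\<close>
definition dominated :: "'a \<Rightarrow> 'a set" where
  "dominated x = {y \<in> K. \<exists>c>0. x - c *\<^sub>R y \<in> K}"

lemma self_dominated: "x \<in> K \<Longrightarrow> x \<in> dominated x"
  unfolding dominated_def using zero_mem by (auto intro!: exI[of _ 1])

lemma dominated_mono:
  assumes "y \<in> dominated x"
  shows "dominated y \<subseteq> dominated x"
proof
  fix z assume "z \<in> dominated y"
  then obtain d where d: "d > 0" "y - d *\<^sub>R z \<in> K" "z \<in> K" by (auto simp: dominated_def)
  obtain c where c: "c > 0" "x - c *\<^sub>R y \<in> K" using assms by (auto simp: dominated_def)
  show "z \<in> dominated x"
    using minus_scaleR_trans[OF c(2) d(2)] c(1) d(1,3)
    by (auto simp: dominated_def intro!: exI[of _ "c * d"])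
qed

lemma dominated_downward:
  assumes "y \<in> dominated x" "z \<in> K" "y - z \<in> K"
  shows "z \<in> dominated x"
proof -
  have "z \<in> dominated y"
    using assms(2,3) by (auto simp: dominated_def intro!: exI[of _ 1])
  with dominated_mono[OF assms(1)] show ?thesis by blast
qed

lemma dominated_add:
  assumes "y \<in> dominated x" "z \<in> dominated x"
  shows "y + z \<in> dominated x"
proof -
  obtain c d where cd: "c > 0" "d > 0" "x - c *\<^sub>R y \<in> K" "x - d *\<^sub>R z \<in> K" "y \<in> K" "z \<in> K"
    using assms by (auto simp: dominated_def)
  define m where "m = min c d / 2"
  have "x - (2 * m) *\<^sub>R y \<in> K" "x - (2 * m) *\<^sub>R z \<in> K"
    using minus_scaleR_mono[OF cd(3) _ cd(5)] minus_scaleR_mono[OF cd(4) _ cd(6)] by (auto simp: m_def)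
  then have "(1/2) *\<^sub>R ((x - (2 * m) *\<^sub>R y) + (x - (2 * m) *\<^sub>R z)) \<in> K"
    by (intro scaleR_mem add_mem) auto
  also have "(1/2) *\<^sub>R ((x - (2 * m) *\<^sub>R y) + (x - (2 * m) *\<^sub>R z)) = x - m *\<^sub>R (y + z)"
    by (simp add: algebra_simps flip: scaleR_add_left)
  finally show ?thesis
    using cd add_mem by (auto simp: dominated_def m_def intro!: exI[of _ m])
qed

lemma dominated_scaleR:
  assumes "y \<in> dominated x" "0 < k"
  shows "k *\<^sub>R y \<in> dominated x"
proof -
  obtain c where "c > 0" "x - c *\<^sub>R y \<in> K" "y \<in> K"
    using assms by (auto simp: dominated_def)
  with assms show ?thesis
    by (auto simp: dominated_def scaleR_mem intro!: exI[of _ "c / k"])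
qed

lemma dominated_zero: "x \<in> K \<Longrightarrow> 0 \<in> dominated x"
  unfolding dominated_def using zero_mem by (auto intro!: exI[of _ 1])

text \<open>
  The span of a face consists of differences of its elements, and \<open>a - b \<in> K\<close> is at most \<open>a\<close>. Thus a
  strictly smaller face has a strictly smaller span, which makes dimension available for induction.
\<close>
lemma span_dominated:
  assumes "x \<in> K" "y \<in> K" "y \<in> span (dominated x)"
  shows "y \<in> dominated x"
proof -
  let ?D = "{a - b | a b. a \<in> dominated x \<and> b \<in> dominated x}"
  have zero: "0 \<in> ?D"
    using dominated_zero[OF assms(1)] by force
  have "subspace ?D"
  proof (rule subspaceI)
    show "0 \<in> ?D" by (rule zero)
  next
    fix u v assume "u \<in> ?D" "v \<in> ?D"
    then obtain a b c d where "u = a - b" "v = c - d"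
        "a \<in> dominated x" "b \<in> dominated x" "c \<in> dominated x" "d \<in> dominated x"
      by blast
    then have "u + v = (a + c) - (b + d)" "a + c \<in> dominated x" "b + d \<in> dominated x"
      by (auto intro: dominated_add)
    then show "u + v \<in> ?D" by blast
  next
    fix k u assume "u \<in> ?D"
    then obtain a b where ab: "u = a - b" "a \<in> dominated x" "b \<in> dominated x"
      by blast
    show "k *\<^sub>R u \<in> ?D"
    proof (cases k "0::real" rule: linorder_cases)
      case equal
      show ?thesis unfolding equal scaleR_zero_left by (rule zero)
    next
      case greater
      have "k *\<^sub>R u = k *\<^sub>R a - k *\<^sub>R b"
        unfolding ab(1) by (rule scaleR_diff_right)
      moreover have "k *\<^sub>R a \<in> dominated x" "k *\<^sub>R b \<in> dominated x"
        using ab greater dominated_scaleR by blast+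
      ultimately show ?thesis by blast
    next
      case less
      have "k *\<^sub>R u = (- k) *\<^sub>R b - (- k) *\<^sub>R a"
        unfolding ab(1) by (simp add: scaleR_diff_right)
      moreover have "(- k) *\<^sub>R a \<in> dominated x" "(- k) *\<^sub>R b \<in> dominated x"
        using ab less dominated_scaleR[of _ x "- k"] by simp_all
      ultimately show ?thesis by blast
    qed
  qed
  moreover have "dominated x \<subseteq> ?D"
    using dominated_zero[OF assms(1)] by force
  ultimately have "y \<in> ?D"
    using assms(3) span_minimal by blast
  then obtain a b where "y = a - b" "a \<in> dominated x" "b \<in> dominated x" by blast
  with assms(2) show ?thesis
    by (intro dominated_downward[of a x y]) (auto simp: dominated_def)
qed

lemma extreme_ray_if_dominated_multiples:
  assumes "x \<in> K" "x \<noteq> 0" and multiples: "\<And>y. y \<in> dominated x \<Longrightarrow> \<exists>k. y = k *\<^sub>R x"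
  shows "{c *\<^sub>R x | c. c \<ge> 0} extreme_ray_of K"
proof -
  let ?R = "{c *\<^sub>R x | c. c \<ge> 0}"
  \<comment> \<open>Every element of the cone with a positive multiple below some point of the ray lies on the ray.\<close>
  have below: "q \<in> ?R" if "q \<in> K" "c *\<^sub>R x - d *\<^sub>R q \<in> K" "d > 0" "c \<ge> 0" for q c d
  proof (cases "c = 0")
    case True
    with that have "- (d *\<^sub>R q) \<in> K" "d *\<^sub>R q \<in> K" by (auto intro: scaleR_mem)
    then have "d *\<^sub>R q = 0" using antisym by blast
    with \<open>d > 0\<close> have "q = 0 *\<^sub>R x" by simp
    then show ?thesis by blast
  next
    case False
    have "(1 / c) *\<^sub>R (c *\<^sub>R x - d *\<^sub>R q) \<in> K" using that by (intro scaleR_mem) auto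
    then have "x - (d / c) *\<^sub>R q \<in> K" using False by (simp add: algebra_simps)
    then have "q \<in> dominated x"
      using that False by (auto simp: dominated_def intro!: exI[of _ "d / c"])
    then obtain k where k: "q = k *\<^sub>R x" using multiples by blast
    have "k \<ge> 0"
    proof (rule ccontr)
      assume "\<not> k \<ge> 0"
      then have "- x = (1 / (- k)) *\<^sub>R q" using k by simp
      moreover have "(1 / (- k)) *\<^sub>R q \<in> K"
        using that \<open>\<not> k \<ge> 0\<close> by (intro scaleR_mem) auto
      ultimately show False using antisym[of x] assms by simp
    qed
    with k show ?thesis by blast
  qed
  have "?R face_of K"
    unfolding face_of_def
  proof (intro conjI ballI impI)
    show "?R \<subseteq> K" using assms scaleR_mem by blast
    show "convex ?R"
    proof (rule convexI)
      fix p q :: 'a and u v :: real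
      assume "p \<in> ?R" "q \<in> ?R" "0 \<le> u" "0 \<le> v"
      then obtain c d where "p = c *\<^sub>R x" "q = d *\<^sub>R x" "c \<ge> 0" "d \<ge> 0" by blast
      then have "u *\<^sub>R p + v *\<^sub>R q = (u * c + v * d) *\<^sub>R x" "u * c + v * d \<ge> 0"
        using \<open>0 \<le> u\<close> \<open>0 \<le> v\<close> by (auto simp: scaleR_add_left)
      then show "u *\<^sub>R p + v *\<^sub>R q \<in> ?R" by blast
    qed
  next
    fix a b p assume ab: "a \<in> K" "b \<in> K" and "p \<in> ?R" "p \<in> open_segment a b"
    then obtain c u where c: "p = c *\<^sub>R x" "c \<ge> 0" and u: "0 < u" "u < 1" "p = (1 - u) *\<^sub>R a + u *\<^sub>R b"
      unfolding in_segment by blast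
    have "c *\<^sub>R x - (1 - u) *\<^sub>R a = u *\<^sub>R b" "c *\<^sub>R x - u *\<^sub>R b = (1 - u) *\<^sub>R a"
      using c(1) u(3) by (simp_all add: eq_diff_eq diff_eq_eq flip: c(1))
    then have "c *\<^sub>R x - (1 - u) *\<^sub>R a \<in> K" "c *\<^sub>R x - u *\<^sub>R b \<in> K"
      using ab u scaleR_mem by simp_all
    then show "a \<in> ?R" "b \<in> ?R"
      using below[OF ab(1), of c "1 - u"] below[OF ab(2), of c u] u c(2) by simp_all
  qed
  with assms(2) show ?thesis unfolding extreme_ray_of_def by blast
qed

end

section \<open>A closed pointed cone is generated by its extreme rays\<close>

lemma dim_less_of_span_psubset:
  fixes S T :: "'a::real_vector set"
  assumes "finite B" "span B = (UNIV :: 'a set)" "span S \<subset> span T"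
  shows "dim S < dim T"
proof -
  obtain C where C: "C \<subseteq> B" "independent C" "B \<subseteq> span C"
    using maximal_independent_subset[of B] by blast
  have "span B \<subseteq> span C" using C(3) by (simp add: span_minimal)
  then have "span C = UNIV" using assms(2) by auto
  moreover have "finite C" using C(1) assms(1) by (rule finite_subset)
  ultimately have "finite_dimensional_vector_space (scaleR :: real \<Rightarrow> 'a \<Rightarrow> 'a) C"
    using C(2)
    by unfold_locales (auto simp: dependent_raw_def span_raw_def algebra_simps)
  then show ?thesis
    using assms(3) unfolding dim_raw_def span_raw_def
    by (rule finite_dimensional_vector_space.dim_psubset)
qed

text \<open>
  If \<open>x\<close> is not on an extreme ray, its face contains some \<open>y\<close> that is not a multiple of \<open>x\<close>.
  Subtracting from \<open>x\<close> as much of \<open>y\<close> as possible, and from \<open>y\<close> as much of \<open>x\<close> as possible, leads to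
  points \<open>z\<close> and \<open>w\<close> of strictly smaller faces, and \<open>x\<close> is a combination of \<open>z\<close> and \<open>w\<close> with
  non-negative coefficients.
\<close>
lemma (in closed_cone) mem_of_extreme_rays:
  assumes fin_dim: "finite B" "span B = (UNIV :: 'a set)"
    and G_add: "\<And>x y. x \<in> G \<Longrightarrow> y \<in> G \<Longrightarrow> x + y \<in> G"
    and G_scaleR: "\<And>x c. x \<in> G \<Longrightarrow> 0 \<le> c \<Longrightarrow> c *\<^sub>R x \<in> G"
    and G_zero: "0 \<in> G"
    and rays: "\<And>R. R extreme_ray_of K \<Longrightarrow> R \<subseteq> G"
    and "x \<in> K"
  shows "x \<in> G"
  using \<open>x \<in> K\<close>
proof (induction "dim (dominated x)" arbitrary: x rule: less_induct)
  case less
  consider "x = 0" | "x \<noteq> 0" "\<And>y. y \<in> dominated x \<Longrightarrow> \<exists>k. y = k *\<^sub>R x"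
    | y where "y \<in> dominated x" "\<nexists>k. y = k *\<^sub>R x" "x \<noteq> 0"
    by blast
  then show ?case
  proof cases
    case 1
    with G_zero show ?thesis by simp
  next
    case 2
    then have "{c *\<^sub>R x | c. c \<ge> 0} \<subseteq> G"
      using less.prems by (intro rays extreme_ray_if_dominated_multiples)
    moreover have "1 *\<^sub>R x \<in> {c *\<^sub>R x | c. c \<ge> 0}" by fastforce
    ultimately show ?thesis by auto
  next
    case 3
    then have "y \<in> K" by (simp add: dominated_def)
    have "y \<noteq> 0" using 3(2) by (metis scaleR_zero_left)
    obtain t where t: "0 \<le> t" "x - t *\<^sub>R y \<in> K" "\<And>s. x - s *\<^sub>R y \<in> K \<Longrightarrow> s \<le> t"
      using largest_multiple_below[OF less.prems \<open>y \<in> K\<close> \<open>y \<noteq> 0\<close>] by blast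
    obtain s where s: "0 \<le> s" "y - s *\<^sub>R x \<in> K" "\<And>s'. y - s' *\<^sub>R x \<in> K \<Longrightarrow> s' \<le> s"
      using largest_multiple_below[OF \<open>y \<in> K\<close> less.prems \<open>x \<noteq> 0\<close>] by blast
    define z w where "z = x - t *\<^sub>R y" and "w = y - s *\<^sub>R x"
    have "t > 0" using 3(1) t(3) by (force simp: dominated_def)
    have smaller: "v \<in> G" if "v \<in> dominated x" "u \<in> dominated x" "u \<notin> dominated v" for u v
    proof (rule less.hyps)
      have "u \<notin> span (dominated v)"
        using span_dominated[of v u] that by (auto simp: dominated_def)
      moreover have "u \<in> span (dominated x)" using that by (simp add: span_base)
      moreover have "span (dominated v) \<subseteq> span (dominated x)"
        using dominated_mono[OF that(1)] by (rule span_mono)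
      ultimately show "dim (dominated v) < dim (dominated x)"
        by (intro dim_less_of_span_psubset[OF fin_dim]) blast
    qed (use that in \<open>simp add: dominated_def\<close>)
    have "z \<in> G"
    proof (rule smaller[OF _ 3(1)])
      have "x - z \<in> K" using \<open>y \<in> K\<close> t(1) by (simp add: z_def scaleR_mem)
      then show "z \<in> dominated x"
        using dominated_downward[OF self_dominated[OF less.prems]] t(2) by (simp add: z_def)
      show "y \<notin> dominated z"
      proof
        assume "y \<in> dominated z"
        then obtain c where "c > 0" "z - c *\<^sub>R y \<in> K" by (auto simp: dominated_def)
        moreover have "z - c *\<^sub>R y = x - (t + c) *\<^sub>R y" by (simp add: z_def algebra_simps)
        ultimately show False using t(3)[of "t + c"] by simp
      qed
    qed
    have "w \<in> G"
    proof (rule smaller[OF _ self_dominated[OF less.prems]])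
      have "y - w \<in> K" using less.prems s(1) by (simp add: w_def scaleR_mem)
      then show "w \<in> dominated x"
        using dominated_downward[OF 3(1)] s(2) by (simp add: w_def)
      show "x \<notin> dominated w"
      proof
        assume "x \<in> dominated w"
        then obtain c where "c > 0" "w - c *\<^sub>R x \<in> K" by (auto simp: dominated_def)
        moreover have "w - c *\<^sub>R x = y - (s + c) *\<^sub>R x" by (simp add: w_def algebra_simps)
        ultimately show False using s(3)[of "s + c"] by simp
      qed
    qed
    \<comment> \<open>Eliminating \<open>y\<close> from the definitions of \<open>z\<close> and \<open>w\<close> expresses \<open>x\<close> through them.\<close>
    have eq: "(1 - t * s) *\<^sub>R x = z + t *\<^sub>R w"
      by (simp add: z_def w_def algebra_simps)
    have "1 - t * s > 0"
    proof (rule ccontr)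
      assume "\<not> 1 - t * s > 0"
      then have "t *\<^sub>R w + (t * s - 1) *\<^sub>R x \<in> K"
        using t s less.prems by (intro add_mem scaleR_mem) (auto simp: w_def)
      also have "t *\<^sub>R w + (t * s - 1) *\<^sub>R x = - z"
        using eq by (simp add: algebra_simps)
      finally have "z = 0" using antisym[of z] t(2) by (simp add: z_def)
      then have "y = (1 / t) *\<^sub>R x" using \<open>t > 0\<close> by (simp add: z_def)
      with 3(2) show False by blast
    qed
    moreover have "x = (1 / (1 - t * s)) *\<^sub>R (z + t *\<^sub>R w)"
      using calculation by (simp flip: eq)
    ultimately show ?thesis
      using G_scaleR G_add \<open>z \<in> G\<close> \<open>w \<in> G\<close> t(1) by (metis less_imp_le zero_le_divide_1_iff)
  qed
qed

definition nonneg_combinations :: "'a::real_vector set \<Rightarrow> 'a set" where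
  "nonneg_combinations E = {\<Sum>e\<in>E. a e *\<^sub>R e | a. \<forall>e\<in>E. 0 \<le> a e}"

locale finitely_generated_cone = closed_cone K for K :: "'a::real_normed_vector set" +
  fixes E :: "'a set"
  assumes finite_gens: "finite E"
    and gens_mem: "e \<in> E \<Longrightarrow> e \<in> K"
    and gens_nonzero: "0 \<notin> E"
    and generates: "x \<in> K \<Longrightarrow> x \<in> nonneg_combinations E"

lemma polyhedral_cone_finitely_generated:
  fixes K :: "'a::real_normed_vector set"
  assumes "closed K" "polyhedral_cone K" "finite B" "span B = (UNIV :: 'a set)"
  obtains E where "finitely_generated_cone K E"
proof -
  interpret closed_cone K
    using assms by unfold_locales (auto simp: polyhedral_cone_def)
  define g where "g R = (SOME x. x \<noteq> 0 \<and> R = {c *\<^sub>R x | c. c \<ge> 0})" for R :: "'a set"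
  have g: "g R \<noteq> 0" "R = {c *\<^sub>R g R | c. c \<ge> 0}" if "R extreme_ray_of K" for R
    using that someI_ex[of "\<lambda>x. x \<noteq> 0 \<and> R = {c *\<^sub>R x | c. c \<ge> 0}"]
    unfolding extreme_ray_of_def g_def by blast+
  define E where "E = g ` {R. R extreme_ray_of K}"
  have fin: "finite E" using assms by (simp add: E_def polyhedral_cone_def)
  show thesis
  proof (rule that[of E], unfold_locales)
    show "finite E" by fact
    show "0 \<notin> E" using g(1) by (auto simp: E_def)
    show "e \<in> K" if "e \<in> E" for e
    proof -
      obtain R where R: "e = g R" "R extreme_ray_of K" using \<open>e \<in> E\<close> by (auto simp: E_def)
      have "1 *\<^sub>R g R \<in> R" by (subst (2) g(2)[OF R(2)]) fastforce
      with R show ?thesis by (auto simp: extreme_ray_of_def face_of_def)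
    qed
    show "x \<in> nonneg_combinations E" if "x \<in> K" for x
    proof (rule mem_of_extreme_rays[OF assms(3,4) _ _ _ _ that])
      fix x y assume "x \<in> nonneg_combinations E" "y \<in> nonneg_combinations E"
      then obtain a b where "x = (\<Sum>e\<in>E. a e *\<^sub>R e)" "y = (\<Sum>e\<in>E. b e *\<^sub>R e)"
          "\<forall>e\<in>E. 0 \<le> a e" "\<forall>e\<in>E. 0 \<le> b e"
        by (auto simp: nonneg_combinations_def)
      then have "x + y = (\<Sum>e\<in>E. (a e + b e) *\<^sub>R e)" "\<forall>e\<in>E. 0 \<le> a e + b e"
        by (auto simp: sum.distrib scaleR_add_left)
      then show "x + y \<in> nonneg_combinations E"
        unfolding nonneg_combinations_def mem_Collect_eq by (intro exI conjI)
    next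
      fix x and c :: real assume "x \<in> nonneg_combinations E" "0 \<le> c"
      then obtain a where "x = (\<Sum>e\<in>E. a e *\<^sub>R e)" "\<forall>e\<in>E. 0 \<le> a e"
        by (auto simp: nonneg_combinations_def)
      then have "c *\<^sub>R x = (\<Sum>e\<in>E. (c * a e) *\<^sub>R e)" "\<forall>e\<in>E. 0 \<le> c * a e"
        using \<open>0 \<le> c\<close> by (auto simp: scaleR_sum_right)
      then show "c *\<^sub>R x \<in> nonneg_combinations E"
        unfolding nonneg_combinations_def mem_Collect_eq by (intro exI conjI)
    next
      show "0 \<in> nonneg_combinations E"
        unfolding nonneg_combinations_def by (force intro: exI[of _ "\<lambda>_. 0"])
    next
      fix R assume R: "R extreme_ray_of K"
      then have "g R \<in> E" by (simp add: E_def)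
      show "R \<subseteq> nonneg_combinations E"
      proof
        fix x assume "x \<in> R"
        then obtain c where c: "x = c *\<^sub>R g R" "c \<ge> 0" using g(2)[OF R] by blast
        have "x = (\<Sum>e\<in>E. (if e = g R then c else 0) *\<^sub>R e)"
          using fin \<open>g R \<in> E\<close> c by (simp add: if_distrib[of "\<lambda>a. a *\<^sub>R _"] sum.delta cong: if_cong)
        with c(2) show "x \<in> nonneg_combinations E"
          unfolding nonneg_combinations_def by force
      qed
    qed
  qed
qed

section \<open>Topology and order of finitely generated cones\<close>

context finitely_generated_cone
begin

lemma combination_mem: "(\<And>e. e \<in> E \<Longrightarrow> 0 \<le> a e) \<Longrightarrow> (\<Sum>e\<in>E. a e *\<^sub>R e) \<in> K"
  by (intro sum_mem scaleR_mem gens_mem)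

text \<open>
  A vanishing convex combination would exhibit the negative of a generator as an element of \<open>K\<close>.
\<close>
lemma zero_not_in_hull: "0 \<notin> convex hull E"
proof
  assume "0 \<in> convex hull E"
  then obtain u where u: "\<forall>e\<in>E. 0 \<le> u e" "sum u E = 1" "(\<Sum>e\<in>E. u e *\<^sub>R e) = 0"
    using finite_gens by (auto simp: convex_hull_finite)
  then obtain d where d: "d \<in> E" "u d \<noteq> 0"
    by (metis sum.neutral zero_neq_one)
  have "- (u d *\<^sub>R d) = (\<Sum>e\<in>E - {d}. u e *\<^sub>R e)"
    using u(3) finite_gens d(1) by (simp add: sum.remove[of E d] neg_eq_iff_add_eq_0)
  also have "\<dots> \<in> K" using u by (intro sum_mem scaleR_mem gens_mem) auto
  finally have "u d *\<^sub>R d = 0"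
    using antisym[of "u d *\<^sub>R d"] u d gens_mem scaleR_mem by blast
  with d gens_nonzero show False by auto
qed

text \<open>
  After scaling the coefficients to total mass 1, this says that the origin has positive distance from
  the convex hull of the generators, which is compact.
\<close>
lemma coefficients_bounded:
  obtains \<kappa> where "\<kappa> > 0"
    "\<And>a. (\<And>e. e \<in> E \<Longrightarrow> 0 \<le> a e) \<Longrightarrow> \<kappa> * (\<Sum>e\<in>E. a e) \<le> norm (\<Sum>e\<in>E. a e *\<^sub>R e)"
proof -
  have "closed (convex hull E)"
    using finite_gens by (intro compact_imp_closed finite_imp_compact_convex_hull)
  then obtain \<kappa> where \<kappa>: "\<kappa> > 0" "\<And>h. h \<in> convex hull E \<Longrightarrow> \<kappa> \<le> norm h"
    using closed_separation[OF _ zero_not_in_hull] by (metis dist_0_norm dist_commute)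
  have "\<kappa> * (\<Sum>e\<in>E. a e) \<le> norm (\<Sum>e\<in>E. a e *\<^sub>R e)" if a: "\<And>e. e \<in> E \<Longrightarrow> 0 \<le> a e" for a
  proof (cases "sum a E = 0")
    case False
    define s where "s = sum a E"
    have "s > 0" using False a sum_nonneg[of E a] by (simp add: s_def less_le)
    have "(\<Sum>e\<in>E. (a e / s) *\<^sub>R e) \<in> convex hull E"
      unfolding convex_hull_finite[OF finite_gens]
      using \<open>s > 0\<close> a by (auto intro!: exI[of _ "\<lambda>e. a e / s"] simp: s_def simp flip: sum_divide_distrib)
    then have "\<kappa> \<le> norm (\<Sum>e\<in>E. (a e / s) *\<^sub>R e)" by (rule \<kappa>(2))
    also have "(\<Sum>e\<in>E. (a e / s) *\<^sub>R e) = (1 / s) *\<^sub>R (\<Sum>e\<in>E. a e *\<^sub>R e)"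
      by (simp add: scaleR_sum_right)
    finally show ?thesis using \<open>s > 0\<close> by (simp add: field_simps flip: s_def)
  qed simp
  with \<kappa>(1) show thesis by (rule that)
qed

text \<open>
  Representations by generators are not unique, but any choice of them for a bounded sequence has
  bounded coefficients and therefore a coefficientwise convergent subsequence.
\<close>
lemma bounded_sequence_coefficients:
  assumes "\<And>n. v n \<in> K" "\<And>n. norm (v n) \<le> b"
  obtains r :: "nat \<Rightarrow> nat" and a :: "nat \<Rightarrow> 'a \<Rightarrow> real" and \<alpha> :: "'a \<Rightarrow> real"
    where "strict_mono r"
    "\<forall>n. \<forall>e\<in>E. 0 \<le> a n e" "\<forall>n. v n = (\<Sum>e\<in>E. a n e *\<^sub>R e)"
    "\<forall>e\<in>E. 0 \<le> \<alpha> e" "\<forall>e\<in>E. (\<lambda>n. a (r n) e) \<longlonglongrightarrow> \<alpha> e"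
proof -
  obtain \<kappa> where \<kappa>: "\<kappa> > 0"
    "\<And>a. (\<And>e. e \<in> E \<Longrightarrow> 0 \<le> a e) \<Longrightarrow> \<kappa> * (\<Sum>e\<in>E. a e) \<le> norm (\<Sum>e\<in>E. a e *\<^sub>R e)"
    using coefficients_bounded by blast
  have "\<forall>n. \<exists>a. v n = (\<Sum>e\<in>E. a e *\<^sub>R e) \<and> (\<forall>e\<in>E. 0 \<le> a e)"
    using generates[OF assms(1)] by (auto simp: nonneg_combinations_def)
  then obtain a where a: "\<And>n. v n = (\<Sum>e\<in>E. a n e *\<^sub>R e)" "\<And>n e. e \<in> E \<Longrightarrow> 0 \<le> a n e"
    by metis
  have "a n e \<in> {0..b / \<kappa>}" if "e \<in> E" for n e
  proof -
    have "a n e \<le> (\<Sum>e\<in>E. a n e)"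
      using that a(2) finite_gens by (intro member_le_sum) auto
    also have "\<dots> \<le> b / \<kappa>"
      using \<kappa>(2)[of "a n", OF a(2)] \<kappa>(1) a(1)[of n] assms(2)[of n] by (simp add: field_simps)
    finally show ?thesis using a(2)[OF that] by simp
  qed
  then obtain r \<alpha> where "strict_mono r" "\<And>e. e \<in> E \<Longrightarrow> \<alpha> e \<in> {0..b / \<kappa>}"
      "\<And>e. e \<in> E \<Longrightarrow> (\<lambda>n. a (r n) e) \<longlonglongrightarrow> \<alpha> e"
    using pointwise_convergent_subsequence_finite[OF finite_gens compact_Icc[of 0 "b / \<kappa>"]] by metis
  then show thesis by (intro that[of r a \<alpha>]) (auto simp: a)
qed

lemma compact_bounded_part: "compact (K \<inter> cball 0 b)"
  unfolding compact_eq_seq_compact_metric seq_compact_def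
proof (intro allI impI)
  fix v :: "nat \<Rightarrow> 'a" assume v: "\<forall>n. v n \<in> K \<inter> cball 0 b"
  then have bounded: "\<And>n. v n \<in> K" "\<And>n. norm (v n) \<le> b" by auto
  obtain r :: "nat \<Rightarrow> nat" and a :: "nat \<Rightarrow> 'a \<Rightarrow> real" and \<alpha> :: "'a \<Rightarrow> real" where r: "strict_mono r"
    and "\<forall>n. \<forall>e\<in>E. 0 \<le> a n e" and a: "\<forall>n. v n = (\<Sum>e\<in>E. a n e *\<^sub>R e)"
    and "\<forall>e\<in>E. 0 \<le> \<alpha> e" and \<alpha>: "\<forall>e\<in>E. (\<lambda>n. a (r n) e) \<longlonglongrightarrow> \<alpha> e"
    using bounded_sequence_coefficients[of v b, OF bounded] .
  have "(\<lambda>n. \<Sum>e\<in>E. a (r n) e *\<^sub>R e) \<longlonglongrightarrow> (\<Sum>e\<in>E. \<alpha> e *\<^sub>R e)"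
    using \<alpha> by (intro tendsto_intros) auto
  then have lim: "(v \<circ> r) \<longlonglongrightarrow> (\<Sum>e\<in>E. \<alpha> e *\<^sub>R e)"
    by (simp add: o_def a)
  moreover have "(\<Sum>e\<in>E. \<alpha> e *\<^sub>R e) \<in> K \<inter> cball 0 b"
    by (rule closed_sequentially[OF _ _ lim]) (use v closed in auto)
  ultimately show "\<exists>l\<in>K \<inter> cball 0 b. \<exists>r. strict_mono r \<and> (v \<circ> r) \<longlonglongrightarrow> l"
    using r by blast
qed

text \<open>
  If \<open>v\<^sub>n\<close> tends to \<open>u\<close>, then along a subsequence the coefficients of \<open>v\<^sub>n\<close> tend to coefficients of \<open>u\<close>.
  Those with positive limit eventually exceed half of it, and the others are non-negative anyway. A cone
  with infinitely many extreme rays can fail to have this property at its boundary: nearby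
  boundary points of a circular cone do not dominate multiples of each other.
\<close>
lemma half_below_nearby:
  assumes "u \<in> K"
  obtains \<delta> where "\<delta> > 0" "\<And>v. v \<in> K \<Longrightarrow> dist v u < \<delta> \<Longrightarrow> v - (1/2) *\<^sub>R u \<in> K"
proof (rule ccontr)
  assume "\<not> thesis"
  have "\<exists>v. v \<in> K \<and> dist v u < 1 / Suc n \<and> v - (1/2) *\<^sub>R u \<notin> K" for n
    using that[of "1 / Suc n"] \<open>\<not> thesis\<close> by auto
  then obtain v where v: "\<And>n. v n \<in> K" "\<And>n. dist (v n) u < 1 / Suc n" "\<And>n. v n - (1/2) *\<^sub>R u \<notin> K"
    by metis
  have "(\<lambda>n. dist (v n) u) \<longlonglongrightarrow> 0"
  proof (rule tendsto_sandwich[OF _ _ tendsto_const LIMSEQ_inverse_real_of_nat])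
    show "\<forall>\<^sub>F n in sequentially. dist (v n) u \<le> inverse (real (Suc n))"
      using v(2) by (intro always_eventually allI) (simp add: inverse_eq_divide less_imp_le)
  qed simp
  then have vlim: "v \<longlonglongrightarrow> u" by (rule tendsto_dist_iff[THEN iffD2])
  have bounded: "norm (v n) \<le> norm u + 1" for n
  proof -
    have "norm (v n) \<le> norm u + dist (v n) u"
      using norm_triangle_sub[of "v n" u] by (simp add: dist_norm)
    also have "dist (v n) u \<le> 1 / Suc n" using v(2)[of n] by simp
    also have "\<dots> \<le> 1" by simp
    finally show ?thesis by simp
  qed
  obtain r :: "nat \<Rightarrow> nat" and a :: "nat \<Rightarrow> 'a \<Rightarrow> real" and \<alpha> :: "'a \<Rightarrow> real" where r: "strict_mono r"
    and nonneg: "\<forall>n. \<forall>e\<in>E. 0 \<le> a n e" and a: "\<forall>n. v n = (\<Sum>e\<in>E. a n e *\<^sub>R e)"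
    and \<alpha>: "\<forall>e\<in>E. 0 \<le> \<alpha> e" "\<forall>e\<in>E. (\<lambda>n. a (r n) e) \<longlonglongrightarrow> \<alpha> e"
    using bounded_sequence_coefficients[of v "norm u + 1", OF v(1) bounded] .
  have "(\<lambda>n. \<Sum>e\<in>E. a (r n) e *\<^sub>R e) \<longlonglongrightarrow> (\<Sum>e\<in>E. \<alpha> e *\<^sub>R e)"
    using \<alpha> by (intro tendsto_intros) auto
  moreover have "(\<lambda>n. \<Sum>e\<in>E. a (r n) e *\<^sub>R e) \<longlonglongrightarrow> u"
    using LIMSEQ_subseq_LIMSEQ[OF vlim r] by (simp add: o_def a)
  ultimately have u: "u = (\<Sum>e\<in>E. \<alpha> e *\<^sub>R e)"
    by (rule LIMSEQ_unique[THEN sym])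
  have "\<forall>\<^sub>F n in sequentially. \<alpha> e / 2 \<le> a (r n) e" if "e \<in> E" for e
  proof (cases "\<alpha> e = 0")
    case True
    with nonneg that show ?thesis by simp
  next
    case False
    then have "\<alpha> e / 2 < \<alpha> e" using \<alpha>(1) that by force
    from order_tendstoD(1)[OF \<alpha>(2)[rule_format, OF that] this] show ?thesis
      by (rule eventually_mono) simp
  qed
  then have "\<forall>\<^sub>F n in sequentially. \<forall>e\<in>E. \<alpha> e / 2 \<le> a (r n) e"
    using finite_gens by (simp add: eventually_ball_finite)
  then obtain n where n: "\<forall>e\<in>E. \<alpha> e / 2 \<le> a (r n) e"
    by (auto simp: eventually_sequentially)
  have "v (r n) - (1/2) *\<^sub>R u = (\<Sum>e\<in>E. (a (r n) e - \<alpha> e / 2) *\<^sub>R e)"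
    by (subst u, subst a[rule_format]) (simp add: scaleR_sum_right scaleR_diff_left sum_subtractf)
  also have "\<dots> \<in> K" using n by (intro combination_mem) auto
  finally show False using v(3) by blast
qed

text \<open>
  A point is comparable with the sum of the generators that occur in any representation of it with
  positive coefficients. This set of generators labels the face of the point; it need not be unique, and
  \<open>support\<close> picks one.
\<close>
definition is_support :: "'a \<Rightarrow> 'a set \<Rightarrow> bool" where
  "is_support x S \<longleftrightarrow> S \<subseteq> E \<and> (\<exists>c>0. x - c *\<^sub>R \<Sum>S \<in> K \<and> \<Sum>S - c *\<^sub>R x \<in> K)"

lemma support_exists:
  assumes "x \<in> K"
  shows "\<exists>S. is_support x S"
proof -
  obtain a where x: "x = (\<Sum>e\<in>E. a e *\<^sub>R e)" and a: "\<And>e. e \<in> E \<Longrightarrow> 0 \<le> a e"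
    using generates[OF assms] by (auto simp: nonneg_combinations_def)
  define S where "S = {e \<in> E. a e > 0}"
  define c where "c = Min (insert 1 (a ` S \<union> (\<lambda>e. 1 / a e) ` S))"
  have finS: "finite S" using finite_gens by (simp add: S_def)
  have "c > 0" using finS by (auto simp: c_def S_def)
  have le: "c \<le> a e" "c \<le> 1 / a e" if "e \<in> S" for e
    unfolding c_def using finS that by (auto intro!: Min_le)
  have xS: "x = (\<Sum>e\<in>S. a e *\<^sub>R e)"
    unfolding x using finite_gens a by (intro sum.mono_neutral_right) (auto simp: S_def less_le)
  have "x - c *\<^sub>R \<Sum>S = (\<Sum>e\<in>S. (a e - c) *\<^sub>R e)"
    unfolding xS by (simp add: scaleR_sum_right scaleR_diff_left sum_subtractf)
  also have "\<dots> \<in> K" using le by (intro sum_mem scaleR_mem gens_mem) (auto simp: S_def)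
  finally have 1: "x - c *\<^sub>R \<Sum>S \<in> K" .
  have "\<Sum>S - c *\<^sub>R x = (\<Sum>e\<in>S. (1 - c * a e) *\<^sub>R e)"
    unfolding xS by (simp add: scaleR_sum_right scaleR_diff_left sum_subtractf)
  also have "\<dots> \<in> K"
    using le(2) by (intro sum_mem scaleR_mem gens_mem) (auto simp: S_def field_simps)
  finally have 2: "\<Sum>S - c *\<^sub>R x \<in> K" .
  have "S \<subseteq> E" by (auto simp: S_def)
  then have "is_support x S"
    unfolding is_support_def using 1 2 \<open>c > 0\<close> by (intro conjI exI[of _ c])
  then show ?thesis ..
qed

definition support :: "'a \<Rightarrow> 'a set" where
  "support x = (SOME S. is_support x S)"

lemma support: "x \<in> K \<Longrightarrow> is_support x (support x)"
  unfolding support_def using support_exists by (rule someI_ex)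

lemma support_in_Pow: "x \<in> K \<Longrightarrow> support x \<in> Pow E"
  using support by (auto simp: is_support_def)

lemma equal_support_comparable:
  assumes "x \<in> K" "y \<in> K" "support x = support y"
  obtains c where "c > 0" "x - c *\<^sub>R y \<in> K"
proof -
  obtain c d where "c > 0" "d > 0" "x - c *\<^sub>R \<Sum>(support x) \<in> K" "\<Sum>(support x) - d *\<^sub>R y \<in> K"
    using support[OF assms(1)] support[OF assms(2)] unfolding assms(3) is_support_def by blast
  then show thesis
    using minus_scaleR_trans[of x c "\<Sum>(support x)" d y] by (intro that[of "c * d"]) auto
qed

end

section \<open>Limit orbits of an equicontinuous family\<close>

locale polyhedral_family = finitely_generated_cone K E + bounded_homogeneous_family K A
  for K E :: "'a::real_normed_vector set" and A +
  assumes order_preserving: "f \<in> A \<Longrightarrow> order_preserving_on K f"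
    and equicontinuous: "equicontinuous_on K A"
begin

text \<open>
  Passing from values to limits of values replaces a compactification of the family itself: at
  points of the cone these sets are compact and they have a closed graph, so that limits of orbits are again orbits.
\<close>
definition successors :: "'a \<Rightarrow> 'a set" where
  "successors x = closure ((\<lambda>f. f x) ` A)"

lemma successors_mem: "x \<in> K \<Longrightarrow> y \<in> successors x \<Longrightarrow> y \<in> K"
  using closure_minimal[of "(\<lambda>f. f x) ` A" K] closed maps by (auto simp: successors_def)

lemma successors_norm_le:
  assumes "x \<in> K" "y \<in> successors x"
  shows "norm y \<le> bound * norm x"
proof -
  have "(\<lambda>f. f x) ` A \<subseteq> cball 0 (bound * norm x)"
    using norm_le_bound assms(1) by auto
  from closure_minimal[OF this closed_cball] assms(2) show ?thesis
    by (auto simp: successors_def)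
qed

lemma successors_approx:
  assumes "y \<in> successors x" "e > 0"
  obtains f where "f \<in> A" "dist (f x) y < e"
  using assms unfolding successors_def closure_approachable by blast

lemma successors_scaleR:
  assumes "x \<in> K" "y \<in> successors x" "c > 0"
  shows "c *\<^sub>R y \<in> successors (c *\<^sub>R x)"
  unfolding successors_def closure_approachable
proof (intro allI impI)
  fix e :: real assume "e > 0"
  with assms obtain f where f: "f \<in> A" "dist (f x) y < e / c"
    using successors_approx[OF assms(2), of "e / c"] by auto
  have "f (c *\<^sub>R x) = c *\<^sub>R f x"
    using homogeneous[OF f(1)] assms by (simp add: homogeneous_on_def)
  then have "dist (f (c *\<^sub>R x)) (c *\<^sub>R y) = c * dist (f x) y"
    using \<open>c > 0\<close> by (simp add: dist_norm flip: scaleR_diff_right)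
  with f(2) \<open>c > 0\<close> have "dist (f (c *\<^sub>R x)) (c *\<^sub>R y) < e"
    by (simp add: field_simps)
  with f(1) show "\<exists>z\<in>(\<lambda>f. f (c *\<^sub>R x)) ` A. dist z (c *\<^sub>R y) < e" by blast
qed

lemma equicontinuous_at:
  assumes "x \<in> K" "e > 0"
  obtains d where "d > 0" "\<And>f y. f \<in> A \<Longrightarrow> y \<in> K \<Longrightarrow> dist y x < d \<Longrightarrow> dist (f y) (f x) < e"
  using equicontinuous assms unfolding equicontinuous_on_def by meson

text \<open>
  The maps realizing \<open>ys n\<close> change with \<open>n\<close>, so pointwise equicontinuity, and not merely continuity of
  each map, is what moves their values from \<open>xs n\<close> to \<open>x\<close>.
\<close>
lemma successors_limit:
  assumes xs: "\<And>n::nat. xs n \<in> K" "xs \<longlonglongrightarrow> x"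
    and ys: "\<And>n. ys n \<in> successors (xs n)" "ys \<longlonglongrightarrow> y"
  shows "y \<in> successors x"
  unfolding successors_def closure_approachable
proof (intro allI impI)
  fix e :: real assume "e > 0"
  have "x \<in> K" using closed_sequentially[OF closed xs] .
  then obtain d where d: "d > 0" "\<And>f z. f \<in> A \<Longrightarrow> z \<in> K \<Longrightarrow> dist z x < d \<Longrightarrow> dist (f z) (f x) < e / 3"
    using equicontinuous_at[of x "e / 3"] \<open>e > 0\<close> by auto
  have "\<forall>\<^sub>F n in sequentially. dist (xs n) x < d \<and> dist (ys n) y < e / 3"
    using tendstoD[OF xs(2) d(1)] tendstoD[OF ys(2), of "e / 3"] \<open>e > 0\<close>
    by (intro eventually_conj) auto
  then obtain n where n: "dist (xs n) x < d" "dist (ys n) y < e / 3"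
    by (auto simp: eventually_sequentially)
  obtain f where f: "f \<in> A" "dist (f (xs n)) (ys n) < e / 3"
    using successors_approx[OF ys(1), of "e / 3"] \<open>e > 0\<close> by auto
  have "dist (f (xs n)) (f x) < e / 3" using d(2) f(1) xs(1) n(1) by blast
  then have "dist (f x) y < e"
    using f(2) n(2) dist_triangle[of "f x" y "ys n"] dist_triangle[of "f x" "ys n" "f (xs n)"]
    by (simp add: dist_commute)
  with f(1) show "\<exists>z\<in>(\<lambda>f. f x) ` A. dist z y < e" by blast
qed

definition limit_orbit :: "(nat \<Rightarrow> 'a) \<Rightarrow> bool" where
  "limit_orbit x \<longleftrightarrow> x 0 \<in> K \<and> (\<forall>n. x (Suc n) \<in> successors (x n))"

lemma limit_orbit_mem: "limit_orbit x \<Longrightarrow> x n \<in> K"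
  by (induction n) (auto simp: limit_orbit_def intro: successors_mem)

lemma limit_orbit_norm_le: "limit_orbit x \<Longrightarrow> norm (x (n + i)) \<le> bound ^ i * norm (x n)"
proof (induction i)
  case (Suc i)
  have "norm (x (n + Suc i)) \<le> bound * norm (x (n + i))"
    using Suc.prems limit_orbit_mem by (intro successors_norm_le) (auto simp: limit_orbit_def)
  also have "\<dots> \<le> bound * (bound ^ i * norm (x n))"
    using Suc bound_nonneg by (intro mult_left_mono) auto
  finally show ?case by (simp add: mult_ac)
qed simp

lemma limit_orbit_shift:
  assumes "limit_orbit x" "c > 0"
  shows "limit_orbit (\<lambda>i. c *\<^sub>R x (n + i))"
  using assms limit_orbit_mem[OF assms(1)]
  by (auto simp: limit_orbit_def intro!: scaleR_mem successors_scaleR)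

text \<open>
  Orbits starting on the unit sphere lie in a product of compact sets, bounded at time \<open>i\<close> by the
  \<open>i\<close>-th power of the norm bound.
\<close>
lemma limit_orbits_compact:
  assumes "\<And>k. limit_orbit (X k)" "\<And>k. norm (X k 0) = 1"
  obtains r x where "strict_mono (r :: nat \<Rightarrow> nat)" "limit_orbit x" "\<forall>i. (\<lambda>k. X (r k) i) \<longlonglongrightarrow> x i"
proof -
  have mem: "X k i \<in> K \<inter> cball 0 (bound ^ i)" for k i
    using limit_orbit_mem[OF assms(1)] limit_orbit_norm_le[OF assms(1), of k 0 i] assms(2) by simp
  obtain r x where r: "strict_mono (r :: nat \<Rightarrow> nat)" and x: "\<And>i. x i \<in> K \<inter> cball 0 (bound ^ i)"
    and lim: "\<And>i. (\<lambda>k. X (r k) i) \<longlonglongrightarrow> x i"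
    using pointwise_convergent_subsequence[of "\<lambda>i. K \<inter> cball 0 (bound ^ i)" X, OF compact_bounded_part mem]
    by metis
  have "x (Suc i) \<in> successors (x i)" for i
  proof (rule successors_limit[of "\<lambda>n. X (r n) i" "x i" "\<lambda>n. X (r n) (Suc i)"])
    show "X (r n) i \<in> K" "X (r n) (Suc i) \<in> successors (X (r n) i)" for n
      using mem[of "r n" i] assms(1)[of "r n"] by (simp_all add: limit_orbit_def)
  qed (rule lim)+
  with x have "limit_orbit x" by (auto simp: limit_orbit_def)
  with r lim show thesis by (intro that) auto
qed

text \<open>
  Errors do not accumulate uncontrollably: equicontinuity at the fixed point \<open>x n\<close> says how closely \<open>x n\<close>
  has to be approximated for the next value to be close to \<open>x (Suc n)\<close>, whichever map is applied.
\<close>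
lemma limit_orbit_approx:
  assumes "limit_orbit x" "e > 0"
  shows "\<exists>g\<in>family_power A n. dist (g (x 0)) (x n) < e"
  using \<open>e > 0\<close>
proof (induction n arbitrary: e)
  case (Suc n)
  obtain d where d: "d > 0" "\<And>f y. f \<in> A \<Longrightarrow> y \<in> K \<Longrightarrow> dist y (x n) < d \<Longrightarrow> dist (f y) (f (x n)) < e / 2"
    using equicontinuous_at[OF limit_orbit_mem[OF assms(1)], of "e / 2"] Suc.prems by auto
  obtain g where g: "g \<in> family_power A n" "dist (g (x 0)) (x n) < d"
    using Suc.IH[OF d(1)] by blast
  obtain f where f: "f \<in> A" "dist (f (x n)) (x (Suc n)) < e / 2"
    using successors_approx[of "x (Suc n)" "x n" "e / 2"] assms(1) Suc.prems by (auto simp: limit_orbit_def)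
  have "g (x 0) \<in> K" using family_power_maps[OF g(1)] limit_orbit_mem[OF assms(1)] .
  then have "dist (f (g (x 0))) (f (x n)) < e / 2" using d(2) f(1) g(2) by blast
  then have "dist ((f \<circ> g) (x 0)) (x (Suc n)) < e"
    using f(2) dist_triangle[of "f (g (x 0))" "x (Suc n)" "f (x n)"] by simp
  moreover have "f \<circ> g \<in> family_power A (n + Suc 0)"
    unfolding family_power_add family_power_1 using f(1) g(1) by blast
  ultimately show ?case by (intro bexI[of _ "f \<circ> g"]) simp_all
qed (simp add: family_power_0)

lemma limit_orbit_through_product:
  assumes "A \<noteq> {}" "f \<in> family_power A n" "x \<in> K"
  shows "\<exists>X. limit_orbit X \<and> X 0 = x \<and> X n = f x"
  using assms(2,3)
proof (induction n arbitrary: f x)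
  case 0
  obtain h where "h \<in> A" using assms(1) by blast
  have "(h ^^ n) x \<in> K" for n using maps[OF \<open>h \<in> A\<close>] 0 by (induction n) auto
  then have "limit_orbit (\<lambda>n. (h ^^ n) x)"
    using 0 \<open>h \<in> A\<close> closure_subset by (fastforce simp: limit_orbit_def successors_def)
  then show ?case using 0 by (intro exI[of _ "\<lambda>n. (h ^^ n) x"]) (simp add: family_power_0)
next
  case (Suc n)
  then obtain h g where hg: "f = h \<circ> g" "h \<in> family_power A n" "g \<in> A"
    by (auto simp: family_power_Suc)
  then obtain X where X: "limit_orbit X" "X 0 = g x" "X n = h (g x)"
    using Suc.IH[of h "g x"] maps Suc.prems by blast
  have "g x \<in> successors x"
    unfolding successors_def by (intro subsetD[OF closure_subset] imageI hg(3))
  then have "limit_orbit (case_nat x X)"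
    using X Suc.prems by (auto simp: limit_orbit_def split: nat.split)
  with X hg show ?case by (intro exI[of _ "case_nat x X"]) simp
qed

section \<open>Orbits of prescribed growth and their limits\<close>

text \<open>
  The growth condition is imposed from time 0 at every later time. This makes the condition closed
  under pointwise limits, at the price that a shifted orbit need not satisfy it.
\<close>
definition grows :: "real \<Rightarrow> (nat \<Rightarrow> 'a) \<Rightarrow> bool" where
  "grows t x \<longleftrightarrow> limit_orbit x \<and> norm (x 0) = 1 \<and> (\<forall>n. t ^ n \<le> norm (x n))"

definition normalized_shift :: "(nat \<Rightarrow> 'a) \<Rightarrow> nat \<Rightarrow> nat \<Rightarrow> 'a" where
  "normalized_shift x n = (\<lambda>i. (1 / norm (x n)) *\<^sub>R x (n + i))"

lemma normalized_shift_orbit: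
  assumes "limit_orbit x" "x n \<noteq> 0"
  shows "limit_orbit (normalized_shift x n)" "norm (normalized_shift x n 0) = 1"
  using limit_orbit_shift[OF assms(1), of "1 / norm (x n)" n] assms(2) by (simp_all add: normalized_shift_def)

lemma grows_nonzero: "grows t x \<Longrightarrow> t > 0 \<Longrightarrow> x n \<noteq> 0"
  unfolding grows_def by (metis norm_zero not_less zero_less_power)

text \<open>
  Take a trajectory with \<open>\<parallel>x\<^sub>n\<parallel> > s\<^sup>n\<close> and start it afresh at the last time \<open>i \<le> n\<close> at which
  \<open>\<parallel>x\<^sub>i\<parallel> \<le> t\<^sup>i\<close>. From there on it grows at rate \<open>t\<close> until time \<open>n\<close>. Since one step multiplies the norm by
  a bounded factor, making up the gap between \<open>t\<close> and \<open>s\<close> takes a time that tends to infinity with \<open>n\<close>.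
\<close>
lemma long_growing_orbit:
  assumes "0 < t" "t < s"
    and large: "\<And>n. n > 0 \<Longrightarrow> \<exists>f\<in>family_power A n. \<exists>x\<in>K. norm x = 1 \<and> s ^ n < norm (f x)"
  shows "\<exists>X. limit_orbit X \<and> norm (X 0) = 1 \<and> (\<forall>j\<le>k. t ^ j \<le> norm (X j))"
proof -
  have "A \<noteq> {}" using large[of 1] by (auto simp: family_power_1)
  \<comment> \<open>Any number exceeding \<open>t\<close> that bounds the norms of the family will do: its quotient by \<open>t\<close> must be at least 1.\<close>
  define M where "M = bound + t + 1"
  have M: "bound \<le> M" "t < M" using bound_nonneg \<open>0 < t\<close> by (auto simp: M_def)
  obtain n0 where n0: "(M / t) ^ k < (s / t) ^ n0"
    using real_arch_pow[of "s / t"] assms by auto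
  define n where "n = Suc n0"
  have n: "(M / t) ^ k < (s / t) ^ n"
    using n0 assms power_increasing[of n0 n "s / t"] by (simp add: n_def)
  obtain f x where fx: "f \<in> family_power A n" "x \<in> K" "norm x = 1" "s ^ n < norm (f x)"
    using large[of n] by (auto simp: n_def)
  obtain X where X: "limit_orbit X" "X 0 = x" "X n = f x"
    using limit_orbit_through_product[OF \<open>A \<noteq> {}\<close> fx(1,2)] by blast
  define I where "I = {i. i \<le> n \<and> norm (X i) \<le> t ^ i}"
  define i where "i = Max I"
  have "finite I" "0 \<in> I" using X(2) fx(3) by (auto simp: I_def)
  then have "i \<in> I" unfolding i_def by (intro Max_in) auto
  then have i: "i \<le> n" "norm (X i) \<le> t ^ i" by (auto simp: I_def)
  have above: "t ^ j < norm (X j)" if "i < j" "j \<le> n" for j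
  proof (rule ccontr)
    assume "\<not> t ^ j < norm (X j)"
    with that have "j \<in> I" by (simp add: I_def)
    then have "j \<le> i" unfolding i_def using \<open>finite I\<close> by (intro Max_ge)
    with that show False by simp
  qed
  have Xn: "norm (X n) \<le> bound ^ (n - i) * norm (X i)"
    using limit_orbit_norm_le[OF X(1), of i "n - i"] i(1) by simp
  have "norm (X n) > 0" using X fx(4) assms by (smt (verit) zero_less_power)
  with Xn have "X i \<noteq> 0" by auto
  have "k < n - i"
  proof (rule ccontr)
    assume "\<not> k < n - i"
    have "s ^ n < norm (X n)" using X fx by simp
    also have "\<dots> \<le> bound ^ (n - i) * norm (X i)" by (rule Xn)
    also have "\<dots> \<le> M ^ (n - i) * t ^ i"
      using i M bound_nonneg \<open>0 < t\<close> by (intro mult_mono power_mono) auto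
    finally have "s ^ n / t ^ n < M ^ (n - i) * t ^ i / t ^ n"
      using \<open>0 < t\<close> by (intro divide_strict_right_mono) auto
    also have "t ^ n = t ^ (n - i) * t ^ i" using i(1) by (simp flip: power_add)
    then have "M ^ (n - i) * t ^ i / t ^ n = (M / t) ^ (n - i)"
      using \<open>0 < t\<close> by (simp add: power_divide)
    also have "\<dots> \<le> (M / t) ^ k"
      using \<open>\<not> k < n - i\<close> M \<open>0 < t\<close> by (intro power_increasing) auto
    finally show False using n by (simp add: power_divide)
  qed
  have "t ^ j \<le> norm (normalized_shift X i j)" if "j \<le> k" for j
  proof (cases "j = 0")
    case True
    then show ?thesis using \<open>X i \<noteq> 0\<close> by (simp add: normalized_shift_def)
  next
    case False
    have "t ^ j * norm (X i) \<le> t ^ j * t ^ i"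
      using i \<open>0 < t\<close> by (intro mult_left_mono) auto
    also have "\<dots> = t ^ (i + j)" by (simp add: power_add mult.commute)
    also have "\<dots> < norm (X (i + j))"
      using that False \<open>k < n - i\<close> by (intro above) auto
    finally show ?thesis using \<open>X i \<noteq> 0\<close> by (simp add: normalized_shift_def pos_le_divide_eq)
  qed
  with normalized_shift_orbit[OF X(1) \<open>X i \<noteq> 0\<close>] show ?thesis by blast
qed

lemma growing_orbit_exists:
  assumes "0 < t" "t < s"
    and large: "\<And>n. n > 0 \<Longrightarrow> \<exists>f\<in>family_power A n. \<exists>x\<in>K. norm x = 1 \<and> s ^ n < norm (f x)"
  shows "\<exists>x. grows t x"
proof -
  have "\<forall>k. \<exists>X. limit_orbit X \<and> norm (X 0) = 1 \<and> (\<forall>j\<le>k. t ^ j \<le> norm (X j))"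
    using long_growing_orbit[OF assms] by blast
  then obtain X where X: "\<And>k. limit_orbit (X k)" "\<And>k. norm (X k 0) = 1"
    "\<And>k j. j \<le> k \<Longrightarrow> t ^ j \<le> norm (X k j)"
    by metis
  obtain r x where r: "strict_mono (r :: nat \<Rightarrow> nat)" and x: "limit_orbit x"
    and lim: "\<forall>i. (\<lambda>k. X (r k) i) \<longlonglongrightarrow> x i"
    using limit_orbits_compact[of X, OF X(1,2)] by blast
  have normlim: "(\<lambda>k. norm (X (r k) j)) \<longlonglongrightarrow> norm (x j)" for j
    using lim by (intro tendsto_norm) auto
  have "t ^ j \<le> norm (x j)" for j
  proof (rule LIMSEQ_le_const[OF normlim])
    show "\<exists>N. \<forall>n\<ge>N. t ^ j \<le> norm (X (r n) j)"
      using X(3) seq_suble[OF r] by (meson le_trans)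
  qed
  moreover have "norm (x 0) = 1"
    using LIMSEQ_unique[OF normlim[of 0]] X(2) by simp
  ultimately show ?thesis using x by (auto simp: grows_def)
qed

definition omega_limits :: "(nat \<Rightarrow> 'a) \<Rightarrow> (nat \<Rightarrow> 'a) set" where
  "omega_limits x = {y. \<exists>r. filterlim r at_top sequentially \<and>
     (\<forall>i. (\<lambda>k. normalized_shift x (r k) i) \<longlonglongrightarrow> y i)}"

text \<open>
  Let \<open>b n = \<parallel>x\<^sub>n\<parallel> / t\<^sup>n\<close>, which is at least 1. At a time \<open>n \<ge> k\<close> where \<open>b\<close> comes within the factor
  \<open>1 - 1/(k+2)\<close> of its infimum over all times from \<open>k\<close> on, the tail of \<open>x\<close> grows at rate \<open>t\<close> up to that
  factor. The factor tends to 1, so limits of such tails grow at rate exactly \<open>t\<close>, whether \<open>b\<close> is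
  bounded or not; it is this exactness that allows the construction to be iterated.
\<close>
lemma growing_omega_limit_exists:
  assumes "grows t x" "t > 0"
  shows "\<exists>y\<in>omega_limits x. grows t y"
proof -
  define b where "b n = norm (x n) / t ^ n" for n
  have b: "1 \<le> b n" for n
    using assms by (simp add: b_def grows_def)
  have "\<exists>n\<ge>k. \<forall>j\<ge>n. (1 - 1 / real (k + 2)) * b n \<le> b j" for k
  proof -
    define m where "m = Inf (b ` {k..})"
    define q where "q = 1 - 1 / real (k + 2)"
    have q: "0 < q" "q < 1" by (auto simp: q_def)
    have "1 \<le> m" unfolding m_def using b by (intro cINF_greatest) auto
    then have "m < m / q" using q by (simp add: field_simps)
    then obtain n where n: "n \<ge> k" "b n < m / q"
      using cInf_lessD[of "b ` {k..}" "m / q"] by (auto simp: m_def)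
    have "q * b n \<le> b j" if "j \<ge> n" for j
    proof -
      have "q * b n \<le> m" using n(2) q by (simp add: field_simps)
      also have "m \<le> b j" unfolding m_def
        using that n(1) b by (intro cINF_lower bdd_belowI[of _ 1]) auto
      finally show ?thesis .
    qed
    with n(1) show ?thesis unfolding q_def by blast
  qed
  then obtain N where N: "\<And>k. N k \<ge> k" "\<And>k j. j \<ge> N k \<Longrightarrow> (1 - 1 / real (k + 2)) * b (N k) \<le> b j"
    by metis
  define X where "X k = normalized_shift x (N k)" for k
  have nz: "x n \<noteq> 0" for n using grows_nonzero[OF assms] .
  have orbit: "limit_orbit x" using assms by (simp add: grows_def)
  have X: "limit_orbit (X k)" "norm (X k 0) = 1" for k
    unfolding X_def by (rule normalized_shift_orbit[OF orbit nz])+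
  have lower: "(1 - 1 / real (k + 2)) * t ^ i \<le> norm (X k i)" for k i
  proof -
    have "(1 - 1 / real (k + 2)) * b (N k) \<le> b (N k + i)" by (rule N(2)) simp
    then have "(1 - 1 / real (k + 2)) * t ^ i * norm (x (N k)) \<le> norm (x (N k + i))"
      using \<open>t > 0\<close> by (simp add: b_def power_add divide_simps mult_ac)
    then show ?thesis using nz by (simp add: X_def normalized_shift_def pos_le_divide_eq)
  qed
  obtain r y where r: "strict_mono (r :: nat \<Rightarrow> nat)" and y: "limit_orbit y"
    and lim: "\<forall>i. (\<lambda>k. X (r k) i) \<longlonglongrightarrow> y i"
    using limit_orbits_compact[of X, OF X] by blast
  have normlim: "(\<lambda>k. norm (X (r k) j)) \<longlonglongrightarrow> norm (y j)" for j
    using lim by (intro tendsto_norm) auto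
  have "(\<lambda>k. 1 - 1 / real (k + 2)) \<longlonglongrightarrow> 1 - 0"
    by (intro tendsto_intros LIMSEQ_ignore_initial_segment lim_1_over_n)
  then have "(\<lambda>k. (1 - 1 / real (r k + 2)) * t ^ j) \<longlonglongrightarrow> (1 - 0) * t ^ j" for j
    using LIMSEQ_subseq_LIMSEQ[OF _ r] by (intro tendsto_mult tendsto_const) (force simp: o_def)
  then have "t ^ j \<le> norm (y j)" for j
    using LIMSEQ_le[OF _ normlim[of j]] lower by force
  moreover have "norm (y 0) = 1"
    using LIMSEQ_unique[OF normlim[of 0]] X(2) by simp
  ultimately have "grows t y" using y by (auto simp: grows_def)
  moreover have "y \<in> omega_limits x"
  proof -
    have "filterlim (\<lambda>k. N (r k)) at_top sequentially"
      by (rule filterlim_at_top_mono[OF filterlim_subseq[OF r]]) (use N(1) in auto)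
    then show ?thesis
      using lim unfolding omega_limits_def X_def by blast
  qed
  ultimately show ?thesis by blast
qed

text \<open>
  A renormalized tail of \<open>y\<close> from time \<open>m\<close> is the limit of the tails of \<open>x\<close> from times \<open>r l + m\<close>, because
  renormalizing twice is the same as renormalizing once. A diagonal choice gives tails of \<open>x\<close> tending to
  \<open>z\<close>.
\<close>
lemma omega_limits_trans:
  assumes y: "y \<in> omega_limits x" and z: "z \<in> omega_limits y" and nz: "\<And>n. y n \<noteq> 0"
  shows "z \<in> omega_limits x"
proof -
  obtain r where r: "filterlim r at_top sequentially" "\<And>i. (\<lambda>k. normalized_shift x (r k) i) \<longlonglongrightarrow> y i"
    using y by (auto simp: omega_limits_def)
  obtain q where q: "filterlim q at_top sequentially" "\<And>i. (\<lambda>k. normalized_shift y (q k) i) \<longlonglongrightarrow> z i"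
    using z by (auto simp: omega_limits_def)
  have shift: "(\<lambda>l. normalized_shift x (r l + m) i) \<longlonglongrightarrow> normalized_shift y m i" for m i
  proof -
    have "(\<lambda>l. (1 / norm (normalized_shift x (r l) m)) *\<^sub>R normalized_shift x (r l) (m + i))
        \<longlonglongrightarrow> normalized_shift y m i"
      unfolding normalized_shift_def[of y] by (intro tendsto_intros r nz) (simp add: nz)
    moreover have "\<forall>\<^sub>F l in sequentially. normalized_shift x (r l) m \<noteq> 0"
      using r(2)[of m] nz by (rule tendsto_imp_eventually_ne)
    then have "\<forall>\<^sub>F l in sequentially.
        (1 / norm (normalized_shift x (r l) m)) *\<^sub>R normalized_shift x (r l) (m + i) =
        normalized_shift x (r l + m) i"
      by eventually_elim (simp add: normalized_shift_def add.assoc)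
    ultimately show ?thesis by (rule Lim_transform_eventually)
  qed
  have "\<exists>l. k \<le> r l \<and> (\<forall>i\<le>k. dist (normalized_shift x (r l + q k) i) (normalized_shift y (q k) i) < 1 / Suc k)" for k
  proof -
    have "\<forall>\<^sub>F l in sequentially. k \<le> r l"
      using r(1) by (simp add: filterlim_at_top)
    moreover have "\<forall>\<^sub>F l in sequentially. \<forall>i\<in>{..k}.
        dist (normalized_shift x (r l + q k) i) (normalized_shift y (q k) i) < 1 / Suc k"
      by (intro eventually_ball_finite ballI tendstoD[OF shift]) auto
    ultimately have "\<forall>\<^sub>F l in sequentially. k \<le> r l \<and> (\<forall>i\<in>{..k}.
        dist (normalized_shift x (r l + q k) i) (normalized_shift y (q k) i) < 1 / Suc k)"
      by (rule eventually_conj)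
    then show ?thesis by (auto simp: eventually_sequentially)
  qed
  then obtain p where p: "\<And>k. k \<le> r (p k)"
    "\<And>k i. i \<le> k \<Longrightarrow> dist (normalized_shift x (r (p k) + q k) i) (normalized_shift y (q k) i) < 1 / Suc k"
    by metis
  have "(\<lambda>k. normalized_shift x (r (p k) + q k) i) \<longlonglongrightarrow> z i" for i
  proof -
    have "(\<lambda>k. dist (normalized_shift x (r (p k) + q k) i) (normalized_shift y (q k) i)) \<longlonglongrightarrow> 0"
    proof (rule tendsto_sandwich[OF _ _ tendsto_const LIMSEQ_inverse_real_of_nat])
      show "\<forall>\<^sub>F k in sequentially. dist (normalized_shift x (r (p k) + q k) i) (normalized_shift y (q k) i)
          \<le> inverse (real (Suc k))"
        using eventually_ge_at_top[of i]
        by (rule eventually_mono) (use p(2) in \<open>force simp: inverse_eq_divide intro: less_imp_le\<close>)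
    qed simp
    then have "(\<lambda>k. normalized_shift x (r (p k) + q k) i - normalized_shift y (q k) i) \<longlonglongrightarrow> 0"
      by (simp add: dist_norm tendsto_norm_zero_iff)
    from tendsto_add[OF this q(2)[of i]] show ?thesis by simp
  qed
  moreover have "filterlim (\<lambda>k. r (p k) + q k) at_top sequentially"
    by (rule filterlim_at_top_mono[OF filterlim_ident]) (rule always_eventually[OF allI[OF trans_le_add1[OF p(1)]]])
  ultimately show ?thesis unfolding omega_limits_def by blast
qed

text \<open>
  Orbits are compared by the finite set \<open>\<Phi> x\<close> of supports at which their omega-limits of growth \<open>t\<close>
  start. For an orbit with the fewest such supports, passing to an omega-limit \<open>y\<close> cannot lose any of
  them, in particular not the support of the starting point of \<open>y\<close>.
\<close>
lemma recurrent_support: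
  assumes "grows t x0" "t > 0"
  shows "\<exists>x y. grows t x \<and> grows t y \<and> y \<in> omega_limits x \<and> support (y 0) = support (x 0)"
proof -
  define \<Phi> where "\<Phi> x = (\<lambda>y. support (y 0)) ` {y \<in> omega_limits x. grows t y}" for x
  have "\<Phi> x \<subseteq> Pow E" for x
    unfolding \<Phi>_def using support_in_Pow by (force simp: grows_def limit_orbit_def)
  then have fin: "finite (\<Phi> x)" for x
    using finite_gens by (meson finite_Pow_iff finite_subset)
  obtain x where x: "grows t x" "\<And>y. grows t y \<Longrightarrow> card (\<Phi> x) \<le> card (\<Phi> y)"
    using assms(1) arg_min_nat_lemma[of "grows t" x0 "\<lambda>x. card (\<Phi> x)"] by blast
  obtain y where y: "y \<in> omega_limits x" "grows t y"
    using growing_omega_limit_exists[OF x(1) assms(2)] by blast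
  have "\<Phi> y \<subseteq> \<Phi> x"
    unfolding \<Phi>_def using omega_limits_trans[OF y(1) _ grows_nonzero[OF y(2) assms(2)]] by blast
  with x(2)[OF y(2)] have "\<Phi> y = \<Phi> x"
    using card_seteq[OF fin] by blast
  moreover have "support (y 0) \<in> \<Phi> x"
    using y unfolding \<Phi>_def by blast
  ultimately have "support (y 0) \<in> \<Phi> y" by simp
  then obtain z where "z \<in> omega_limits y" "grows t z" "support (y 0) = support (z 0)"
    unfolding \<Phi>_def by blast
  with y(2) show ?thesis by (intro exI[of _ y] exI[of _ z]) simp
qed

section \<open>The joint spectral radius is at most the generalized spectral radius\<close>

lemma family_power_order_preserving:
  "g \<in> family_power A n \<Longrightarrow> x \<in> K \<Longrightarrow> y \<in> K \<Longrightarrow> x - y \<in> K \<Longrightarrow> g x - g y \<in> K"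
proof (induction n arbitrary: g x y)
  case (Suc n)
  then obtain h f where hf: "g = h \<circ> f" "h \<in> family_power A n" "f \<in> A"
    by (auto simp: family_power_Suc)
  have "f x - f y \<in> K"
    using order_preserving[OF hf(3)] Suc.prems by (simp add: order_preserving_on_def cone_ge_def)
  with hf Suc.IH[of h "f x" "f y"] Suc.prems maps show ?case by simp
qed (simp add: family_power_0)

text \<open>
  By monotonicity and homogeneity the inequality \<open>g w \<ge> d w\<close> can be iterated. To turn \<open>g\<^sup>m w \<ge> d\<^sup>m w\<close>
  into an estimate of norms, note that if \<open>g\<^sup>m w / d\<^sup>m\<close> were small, then \<open>g\<^sup>m w / d\<^sup>m - w\<close> would be an
  element of \<open>K\<close> close to \<open>- w\<close>, which has positive distance from \<open>K\<close>.
\<close>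
lemma cone_spectral_radius_ge_of_expansion:
  assumes g: "g \<in> family_power A n" and "w \<in> K" "norm w = 1" "d > 0" and exp: "g w - d *\<^sub>R w \<in> K"
  shows "ennreal d \<le> cone_spectral_radius K g"
proof -
  have mem: "(g ^^ m) w \<in> K" for m
    using funpow_in_family_power[OF g] family_power_maps \<open>w \<in> K\<close> by blast
  have iter: "(g ^^ m) w - d ^ m *\<^sub>R w \<in> K" for m
  proof (induction m)
    case (Suc m)
    have "g ((g ^^ m) w) - g (d ^ m *\<^sub>R w) \<in> K"
      using Suc mem \<open>w \<in> K\<close> \<open>d > 0\<close> by (intro family_power_order_preserving[OF g]) (auto intro: scaleR_mem)
    moreover have "g (d ^ m *\<^sub>R w) = d ^ m *\<^sub>R g w"
      using family_power_scaleR[OF g \<open>w \<in> K\<close>] \<open>d > 0\<close> by simp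
    ultimately have "(g ^^ Suc m) w - d ^ m *\<^sub>R g w \<in> K" by simp
    from minus_scaleR_trans[OF this exp] \<open>d > 0\<close> show ?case by (simp add: mult.commute)
  qed (simp add: zero_mem)
  have "- w \<notin> K" using antisym[OF \<open>w \<in> K\<close>] \<open>norm w = 1\<close> by auto
  then obtain e where e: "e > 0" "\<And>z. z \<in> K \<Longrightarrow> e \<le> dist z (- w)"
    using closed_separation[OF closed] by blast
  show ?thesis
  proof (rule cone_spectral_radius_ge[OF singleton_family[OF g] e(1) _ \<open>w \<in> K\<close> \<open>norm w = 1\<close>])
    fix m
    have "(1 / d ^ m) *\<^sub>R ((g ^^ m) w - d ^ m *\<^sub>R w) \<in> K"
      using iter \<open>d > 0\<close> by (intro scaleR_mem) auto
    then have "e \<le> dist ((1 / d ^ m) *\<^sub>R ((g ^^ m) w - d ^ m *\<^sub>R w)) (- w)" by (rule e(2))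
    also have "\<dots> = norm ((g ^^ m) w) / d ^ m"
      using \<open>d > 0\<close> by (simp add: dist_norm scaleR_diff_right)
    finally show "e * d ^ m \<le> norm ((g ^^ m) w)"
      using \<open>d > 0\<close> by (simp add: field_simps)
  qed (use \<open>d > 0\<close> in simp)
qed

text \<open>
  At infinitely many times \<open>j\<close> the direction of \<open>x\<^sub>j\<close> is close to a point \<open>u \<ge> c w\<close>, where \<open>w = x\<^sub>0\<close>.
  Hence \<open>x\<^sub>j \<ge> (c/2) t\<^sup>j w\<close>, and some product \<open>g\<close> of length \<open>j\<close> has \<open>g w\<close> so close to \<open>x\<^sub>j\<close> that
  \<open>g w \<ge> (c/4) t\<^sup>j w\<close>. For large \<open>j\<close> the constant is absorbed by the gap between \<open>s\<close> and \<open>t\<close>.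
\<close>
lemma generalized_ge_of_growing_orbit:
  assumes "grows t x0" "0 < s" "s < t"
  shows "ennreal s \<le> generalized_spectral_radius K A"
proof (rule generalized_spectral_radius_ge)
  fix n0 :: nat
  have "t > 0" using assms by simp
  obtain x y where x: "grows t x" and y: "grows t y" "y \<in> omega_limits x" and supp: "support (y 0) = support (x 0)"
    using recurrent_support[OF assms(1) \<open>t > 0\<close>] by blast
  define w where "w = x 0"
  define u where "u = y 0"
  have w: "w \<in> K" "norm w = 1" and u: "u \<in> K"
    using x y(1) by (auto simp: grows_def limit_orbit_def w_def u_def)
  have orbit: "limit_orbit x" using x by (simp add: grows_def)
  obtain c where c: "c > 0" "u - c *\<^sub>R w \<in> K"
    using equal_support_comparable[OF u w(1)] supp by (auto simp: u_def w_def)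
  obtain \<delta> where \<delta>: "\<delta> > 0" "\<And>v. v \<in> K \<Longrightarrow> dist v u < \<delta> \<Longrightarrow> v - (1/2) *\<^sub>R u \<in> K"
    using half_below_nearby[OF u] by blast
  obtain r where r: "filterlim r at_top sequentially" "\<And>i. (\<lambda>k. normalized_shift x (r k) i) \<longlonglongrightarrow> y i"
    using y(2) by (auto simp: omega_limits_def)
  have "(\<lambda>j. (s / t) ^ j) \<longlonglongrightarrow> 0"
    using assms by (intro LIMSEQ_realpow_zero) auto
  then have "\<forall>\<^sub>F j in sequentially. (s / t) ^ j < c / 4"
    using c(1) by (intro order_tendstoD(2)) auto
  then have "\<forall>\<^sub>F k in sequentially. (s / t) ^ r k < c / 4 \<and> n0 \<le> r k \<and> dist (normalized_shift x (r k) 0) u < \<delta>"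
    using r(1) tendstoD[OF r(2)[of 0] \<delta>(1)] unfolding u_def
    by (intro eventually_conj) (auto simp: filterlim_at_top dest: eventually_compose_filterlim)
  then obtain j where j: "(s / t) ^ j < c / 4" "n0 \<le> j" "dist (normalized_shift x j 0) u < \<delta>"
    by (auto simp: eventually_sequentially)
  have nz: "x j \<noteq> 0" using grows_nonzero[OF x \<open>t > 0\<close>] .
  have xj: "x j \<in> K" using limit_orbit_mem[OF orbit] .
  have "normalized_shift x j 0 \<in> K"
    using xj by (auto simp: normalized_shift_def intro: scaleR_mem)
  then have "normalized_shift x j 0 - (1/2) *\<^sub>R u \<in> K" using \<delta>(2) j(3) by blast
  from minus_scaleR_trans[OF this c(2)]
  have "norm (x j) *\<^sub>R (normalized_shift x j 0 - (1/2 * c) *\<^sub>R w) \<in> K" by (intro scaleR_mem) auto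
  then have "x j - (norm (x j) * (1/2 * c)) *\<^sub>R w \<in> K"
    using nz by (simp add: normalized_shift_def scaleR_diff_right)
  moreover obtain \<eta> where \<eta>: "\<eta> > 0" "\<And>v. v \<in> K \<Longrightarrow> dist v (x j) < \<eta> \<Longrightarrow> v - (1/2) *\<^sub>R x j \<in> K"
    using half_below_nearby[OF xj] by blast
  obtain g where g: "g \<in> family_power A j" "dist (g w) (x j) < \<eta>"
    using limit_orbit_approx[OF orbit \<eta>(1)] unfolding w_def by blast
  have "g w - (1/2) *\<^sub>R x j \<in> K"
    using \<eta>(2) family_power_maps[OF g(1) w(1)] g(2) by blast
  ultimately have "g w - (1/2 * (norm (x j) * (1/2 * c))) *\<^sub>R w \<in> K"
    using minus_scaleR_trans[of "g w" "1/2" "x j" "norm (x j) * (1/2 * c)" w] by simp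
  moreover have "s ^ j \<le> 1/2 * (norm (x j) * (1/2 * c))"
  proof -
    have "s ^ j \<le> c / 4 * t ^ j"
      using j(1) \<open>t > 0\<close> by (simp add: power_divide divide_less_eq)
    also have "\<dots> \<le> c / 4 * norm (x j)"
      using c(1) x by (intro mult_left_mono) (auto simp: grows_def)
    finally show ?thesis by (simp add: mult_ac)
  qed
  ultimately have "g w - s ^ j *\<^sub>R w \<in> K"
    using minus_scaleR_mono w(1) by blast
  then have "ennreal (s ^ j) \<le> cone_spectral_radius K g"
    using cone_spectral_radius_ge_of_expansion[OF g(1) w] \<open>0 < s\<close> by simp
  with g(1) j(2) show "\<exists>j\<ge>n0. \<exists>g\<in>family_power A j. ennreal (s ^ j) \<le> cone_spectral_radius K g"
    by blast
qed (use assms in simp)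

lemma joint_le_generalized: "joint_spectral_radius K A \<le> generalized_spectral_radius K A"
proof (rule ccontr)
  assume "\<not> ?thesis"
  then have less: "generalized_spectral_radius K A < joint_spectral_radius K A" by simp
  then obtain a where a: "generalized_spectral_radius K A < ennreal a" "ennreal a < joint_spectral_radius K A" "0 \<le> a"
    using dense by (metis ennreal_cases less_top_ennreal order_less_imp_not_less top.extremum_strict)
  then obtain b where b: "ennreal a < ennreal b" "ennreal b < joint_spectral_radius K A" "0 \<le> b"
    using dense by (metis ennreal_cases less_top_ennreal order_less_imp_not_less top.extremum_strict)
  have "a > 0" using a(1,3) by (cases "a = 0") auto
  have "a < b" using b a(3) by (simp add: ennreal_less_iff)
  define t where "t = (a + b) / 2"
  have t: "a < t" "t < b" using \<open>a < b\<close> by (auto simp: t_def)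
  have "\<exists>f\<in>family_power A n. \<exists>x\<in>K. norm x = 1 \<and> b ^ n < norm (f x)" if "n > 0" for n
  proof -
    have "ennreal b < (SUP f\<in>family_power A n. ennroot n (cone_norm K f))"
      using less_le_trans[OF b(2)[unfolded joint_spectral_radius_def] INF_lower[of n]] that by simp
    then obtain f where f: "f \<in> family_power A n" "ennreal b < ennroot n (cone_norm K f)"
      by (auto simp: less_SUP_iff)
    then have "ennreal (b ^ n) < cone_norm K f"
      using ennroot_le_iff[OF that b(3)] by (simp add: not_le[symmetric])
    then obtain x where "x \<in> K" "norm x = 1" "ennreal (b ^ n) < ennreal (norm (f x))"
      unfolding cone_norm_def by (auto simp: less_SUP_iff)
    with f(1) b(3) show ?thesis by (auto simp: ennreal_less_iff)
  qed
  then obtain x where "grows t x"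
    using growing_orbit_exists[of t b] t \<open>a > 0\<close> by auto
  then have "ennreal a \<le> generalized_spectral_radius K A"
    using generalized_ge_of_growing_orbit \<open>a > 0\<close> t(1) by blast
  with a(1) show False by simp
qed

end

section \<open>The Berger--Wang formula\<close>

theorem theorem2p1:
  fixes K :: "'a::real_normed_vector set" and A :: "('a \<Rightarrow> 'a) set"
  assumes fin_dim: "\<exists>B::'a set. finite B \<and> span B = UNIV"
    and "closed K"
    and "polyhedral_cone K"
    and maps: "\<And>f. f \<in> A \<Longrightarrow> f \<in> K \<rightarrow> K"
    and "\<And>f. f \<in> A \<Longrightarrow> order_preserving_on K f"
    and "\<And>f. f \<in> A \<Longrightarrow> homogeneous_on K f"
    and "bounded_family_on K A"
    and "equicontinuous_on K A"
  shows "generalized_spectral_radius K A = joint_spectral_radius K A"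
proof -
  obtain B :: "'a set" where "finite B" "span B = UNIV" using fin_dim by blast
  then obtain E where "finitely_generated_cone K E"
    using polyhedral_cone_finitely_generated[OF assms(2,3)] by blast
  then interpret finitely_generated_cone K E .
  interpret polyhedral_family K E A
    by unfold_locales (use is_wedge assms in \<open>auto simp: Pi_iff\<close>)
  show ?thesis
    using generalized_le_joint joint_le_generalized by (rule order_antisym)
qed

end
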